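(* There exist absolute constants $c_0>0$ and $\eta>0$ such that the following holds. Let $\bm{M}_\star\in\mathbb{R}^{n_1\times n_2}$ have rank $r$, with ground-truth factors $\bm{X}_\star,\bm{Y}_\star$, $\bm{Z}_\star$, $\sigma_{\max},\sigma_{\min},\kappa$ as in the context. Let $\bm{Z}_0=\begin{bmatrix}\bm{X}_0\\ \bm{Y}_0\end{bmatrix}\in\mathbb{R}^{(n_1+n_2)\times r}$ be any initialization satisfying \[ \min_{\bm{R}\in\mathcal{O}^{r\times r}}\|\bm{Z}_0\bm{R}-\bm{Z}_\star\|_{\mathrm{F}}\le c_0\,\frac{1}{\kappa^{3/2}}\,\sigma_{\min}^{1/2}, \] and define the gradient descent iterates \[ \bm{X}_{t+1}=\bm{X}_t-\frac{\eta}{\sigma_{\max}}(\bm{X}_t\bm{Y}_t^\top-\bm{M}_\star)\bm{Y}_t,\qquad \bm{Y}_{t+1}=\bm{Y}_t-\frac{\eta}{\sigma_{\max}}(\bm{X}_t\bm{Y}_t^\top-\bm{M}_\star)^\top\bm{X}_t, \] with $\bm{Z}_t=\begin{bmatrix}\bm{X}_t\\ \bm{Y}_t\end{bmatrix}$. Then for all $t\ge0$, \[ \mathrm{dist}(\bm{Z}_t,\bm{Z}_\star)\le\Big(1-\frac{\eta}{50\kappa}\Big)^t\,\mathrm{dist}(\bm{Z}_0,\bm{Z}_\star). \]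
   Context: $\bm{M}_\star\in\mathbb{R}^{n_1\times n_2}$ has rank $r$ and compact SVD $\bm{M}_\star=\bm{U}_\star\bm{\Sigma}_\star\bm{V}_\star^\top$; $\bm{X}_\star=\bm{U}_\star\bm{\Sigma}_\star^{1/2}$, $\bm{Y}_\star=\bm{V}_\star\bm{\Sigma}_\star^{1/2}$, $\bm{Z}_\star=\begin{bmatrix}\bm{X}_\star\\ \bm{Y}_\star\end{bmatrix}$. $\sigma_{\max}=\sigma_1(\bm{M}_\star)$, $\sigma_{\min}=\sigma_r(\bm{M}_\star)$, $\kappa=\sigma_{\max}/\sigma_{\min}$. $\mathcal{O}^{r\times r}$ denotes the $r\times r$ orthogonal matrices. For $\bm{Z}=\begin{bmatrix}\bm{X}\\ \bm{Y}\end{bmatrix}$, $\mathrm{dist}(\bm{Z},\bm{Z}_\star)=\inf_{\bm{P}\in\mathbb{R}^{r\times r}\text{ invertible}}\sqrt{\|\bm{X}\bm{P}-\bm{X}_\star\|_{\mathrm{F}}^2+\|\bm{Y}\bm{P}^{-\top}-\bm{Y}_\star\|_{\mathrm{F}}^2}$, where $\bm{P}^{-\top}=(\bm{P}^{-1})^\top$. *)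

theory Defs
  imports "Jordan_Normal_Form.Matrix"
begin

definition frob :: "real mat \<Rightarrow> real" where
  "frob A = sqrt (\<Sum>i<dim_row A. \<Sum>j<dim_col A. (A $$ (i,j))\<^sup>2)"

definition stack :: "real mat \<Rightarrow> real mat \<Rightarrow> real mat" where
  "stack X Y = mat (dim_row X + dim_row Y) (dim_col X)
     (\<lambda>(i,j). if i < dim_row X then X $$ (i,j) else Y $$ (i - dim_row X, j))"

definition orth_mats :: "nat \<Rightarrow> real mat set" where
  "orth_mats r = {R. R \<in> carrier_mat r r \<and> transpose_mat R * R = 1\<^sub>m r}"

definition diag_sqrt :: "real mat \<Rightarrow> real mat" where
  "diag_sqrt S = mat (dim_row S) (dim_col S) (\<lambda>(i,j). if i = j then sqrt (S $$ (i,i)) else 0)"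

definition compact_svd :: "nat \<Rightarrow> nat \<Rightarrow> nat \<Rightarrow> real mat \<Rightarrow> real mat \<Rightarrow> real mat \<Rightarrow> real mat \<Rightarrow> bool" where
  "compact_svd n1 n2 r M U S V \<longleftrightarrow>
     M \<in> carrier_mat n1 n2 \<and> U \<in> carrier_mat n1 r \<and> S \<in> carrier_mat r r \<and> V \<in> carrier_mat n2 r \<and>
     transpose_mat U * U = 1\<^sub>m r \<and> transpose_mat V * V = 1\<^sub>m r \<and>
     diagonal_mat S \<and> (\<forall>i<r. S $$ (i,i) > 0) \<and>
     (\<forall>i j. i \<le> j \<longrightarrow> j < r \<longrightarrow> S $$ (j,j) \<le> S $$ (i,i)) \<and>
     M = U * S * transpose_mat V"

definition sigma_max :: "real mat \<Rightarrow> real" where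
  "sigma_max S = Max {S $$ (i,i) | i. i < dim_row S}"

definition sigma_min :: "real mat \<Rightarrow> real" where
  "sigma_min S = Min {S $$ (i,i) | i. i < dim_row S}"

(* dist(Z, Z_star), infimum over invertible P (Q = P^{-1}, so Y P^{-T} = Y Q^T) *)
definition factor_dist :: "real mat \<Rightarrow> real mat \<Rightarrow> real mat \<Rightarrow> real mat \<Rightarrow> real" where
  "factor_dist X Y Xs Ys = Inf {sqrt ((frob (X * P - Xs))\<^sup>2 + (frob (Y * transpose_mat Q - Ys))\<^sup>2) | P Q.
       P \<in> carrier_mat (dim_col X) (dim_col X) \<and> Q \<in> carrier_mat (dim_col X) (dim_col X) \<and>
       P * Q = 1\<^sub>m (dim_col X) \<and> Q * P = 1\<^sub>m (dim_col X)}"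

end

theory Submission
  imports Defs "HOL-Analysis.Convex" "Jordan_Normal_Form.Determinant"
begin

text \<open>
  Let $P$ be an almost optimal alignment of the iterate $(X_t, Y_t)$ and $X = X_t P$, $Y = Y_t P^{-T}$.
  In these coordinates a gradient step is the step for $(X, Y)$ with the two gradients multiplied by
  $P^T P$ and its inverse, so $P^T P \approx I$ is needed. This follows from the imbalance
  $D_t = X_t^T X_t - Y_t^T Y_t$: writing $W = P^T P$, we have $X^T X - W Y^T Y W = P^T D_t P$, and testing
  $W Y^T Y W - Y^T Y$ against $W - I$ bounds $W - I$, because $X^T X \approx Y^T Y$. The imbalance changes only to
  second order in the step size, so it stays small along the whole trajectory; the potential
  $\|D_t\|_F + \kappa\, \mathrm{dist}^2$ is nonincreasing.

  Strong convexity holds up to the gauge defect $\Gamma = X^T (X - X_\star) - (Y - Y_\star)^T Y$, which vanishes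
  at an optimal alignment. Existence of an optimal alignment is not used: moving $P$ to $P (I - s \Gamma)$ decreases
  the squared error by a multiple of $\|\Gamma\|_F^2$, so $\|\Gamma\|_F^2$ is bounded by the gap between
  the squared error and the squared distance, and this gap tends to $0$ when passing to the infimum over $P$.
\<close>

section \<open>Finitely supported infinite matrices\<close>

text \<open>Write \<alpha>, \<beta> for the square roots of \<sigma>_min, \<sigma>_max, \<delta> for
  the aligned error and m for the norm of the residual. Per unit step length, descent gains about
  m^2, where m is at least of order \<alpha> \<delta> up to the gauge defect. Multiplying gradients
  of size \<beta> m by P^T P instead of I costs \<beta> |P^T P - I| m \<delta>, so P^T P - I has to
  be of order \<alpha> / \<beta>. Testing against W - I bounds it by a multiple of |D| / \<alpha>^2
  + \<beta> \<delta> / \<alpha>^2. Hence two thresholds are to be kept along the trajectory: |D| of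
  order \<alpha>^3 / \<beta> and \<delta> of order \<alpha>^3 / \<beta>^2. The initial radius is a
  multiple of \<alpha>^4 / \<beta>^3, so |D| starts at order \<alpha>^4 / \<beta>^2, within the
  first threshold as \<alpha> \<le> \<beta>. One step adds at most order dist^2 to |D|, and dist^2
  decays by a factor 1 - O(1/\<kappa>), so the total growth is of order \<kappa> times the initial
  dist^2. This explains the weight \<kappa> in the potential.\<close>

text \<open>
  Matrices of all sizes are embedded in one type of finitely supported infinite matrices, which is a
  non-unital normed algebra and an inner product space; no dimension side conditions are left.
\<close>

typedef fmat = "{f :: nat \<Rightarrow> nat \<Rightarrow> real. \<exists>N. \<forall>i j. N \<le> i \<or> N \<le> j \<longrightarrow> f i j = 0}"
  morphisms entry Abs_fmat
  by (rule exI[of _ "\<lambda>i j. 0"]) simp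

setup_lifting type_definition_fmat

lemma fmat_eqI: "(\<And>i j. entry A i j = entry B i j) \<Longrightarrow> A = B"
  by (metis entry_inject ext)

definition supported :: "nat \<Rightarrow> fmat \<Rightarrow> bool" where
  "supported N A \<longleftrightarrow> (\<forall>i j. N \<le> i \<or> N \<le> j \<longrightarrow> entry A i j = 0)"

lemma common_support:
  assumes "finite \<A>"
  obtains N where "\<forall>A\<in>\<A>. supported N A"
proof -
  have "\<exists>N. \<forall>A\<in>\<A>. supported N A"
    using assms
  proof (induction rule: finite_induct)
    case (insert A \<A>)
    then obtain N where "\<forall>B\<in>\<A>. supported N B" by blast
    moreover obtain M where "supported M A"
      using entry[of A] unfolding supported_def by blast
    ultimately have "\<forall>B\<in>insert A \<A>. supported (max M N) B"
      by (fastforce simp: supported_def)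
    then show ?case by blast
  qed simp
  then show thesis using that by blast
qed

text \<open>Products and inner products sum over the nonzero entries of their left argument. That
  index set is finite, so the definitions need not choose a bound on the support; this rule then
  replaces the set by any convenient finite range.\<close>

lemma sum_nonzero_eq:
  fixes f g :: "'a \<Rightarrow> real"
  assumes "finite S" "\<And>k. k \<notin> S \<Longrightarrow> f k = 0"
  shows "(\<Sum>k | f k \<noteq> 0. f k * g k) = (\<Sum>k\<in>S. f k * g k)"
  by (rule sum.mono_neutral_left) (use assms in auto)

section \<open>Ring structure, inner product and Frobenius norm\<close>

instantiation fmat :: ring
begin

lift_definition zero_fmat :: fmat is "\<lambda>i j. 0" by simp

lift_definition plus_fmat :: "fmat \<Rightarrow> fmat \<Rightarrow> fmat" is "\<lambda>f g i j. f i j + g i j"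
proof -
  fix f g :: "nat \<Rightarrow> nat \<Rightarrow> real"
  assume "\<exists>N. \<forall>i j. N \<le> i \<or> N \<le> j \<longrightarrow> f i j = 0" "\<exists>N. \<forall>i j. N \<le> i \<or> N \<le> j \<longrightarrow> g i j = 0"
  then obtain M N where "\<forall>i j. M \<le> i \<or> M \<le> j \<longrightarrow> f i j = 0" "\<forall>i j. N \<le> i \<or> N \<le> j \<longrightarrow> g i j = 0"
    by blast
  then show "\<exists>N. \<forall>i j. N \<le> i \<or> N \<le> j \<longrightarrow> f i j + g i j = 0"
    by (intro exI[of _ "max M N"]) auto
qed

lift_definition uminus_fmat :: "fmat \<Rightarrow> fmat" is "\<lambda>f i j. - f i j" by simp

definition minus_fmat :: "fmat \<Rightarrow> fmat \<Rightarrow> fmat" where "minus_fmat A B = A + - B"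

lift_definition times_fmat :: "fmat \<Rightarrow> fmat \<Rightarrow> fmat"
  is "\<lambda>f g i j. \<Sum>k | f i k \<noteq> 0. f i k * g k j"
proof -
  fix f g :: "nat \<Rightarrow> nat \<Rightarrow> real"
  assume "\<exists>N. \<forall>i j. N \<le> i \<or> N \<le> j \<longrightarrow> f i j = 0" "\<exists>N. \<forall>i j. N \<le> i \<or> N \<le> j \<longrightarrow> g i j = 0"
  then obtain M N where "\<forall>i j. M \<le> i \<or> M \<le> j \<longrightarrow> f i j = 0" "\<forall>i j. N \<le> i \<or> N \<le> j \<longrightarrow> g i j = 0"
    by blast
  then show "\<exists>N. \<forall>i j. N \<le> i \<or> N \<le> j \<longrightarrow> (\<Sum>k | f i k \<noteq> 0. f i k * g k j) = 0"
    by (intro exI[of _ "max M N"]) auto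
qed

lemma entry_times:
  assumes "supported N A"
  shows "entry (A * B) i j = (\<Sum>k<N. entry A i k * entry B k j)"
  using assms unfolding times_fmat.rep_eq supported_def
  by (intro sum_nonzero_eq) auto

lemma supported_times:
  assumes "supported N A" "supported N B"
  shows "supported N (A * B)"
  using assms by (auto simp: supported_def[of N "A * B"] entry_times)
     (auto simp: supported_def)

instance
proof
  fix A B C :: fmat
  show "A + B + C = A + (B + C)" "A + B = B + A" "0 + A = A" "- A + A = 0" "A - B = A + - B"
    by (auto intro!: fmat_eqI simp: plus_fmat.rep_eq zero_fmat.rep_eq uminus_fmat.rep_eq minus_fmat_def)
  obtain N where "\<forall>D\<in>{A, B, C, A + B}. supported N D"
    using common_support by (metis finite.emptyI finite.insertI)
  then have N: "supported N A" "supported N B" "supported N C" "supported N (A + B)" by auto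
  show "A * B * C = A * (B * C)"
  proof (rule fmat_eqI)
    fix i j
    have "entry (A * B * C) i j = (\<Sum>l<N. \<Sum>k<N. entry A i k * (entry B k l * entry C l j))"
      by (simp add: entry_times[OF supported_times[OF N(1,2)]] entry_times[OF N(1)]
          sum_distrib_right mult.assoc)
    also have "\<dots> = (\<Sum>k<N. \<Sum>l<N. entry A i k * (entry B k l * entry C l j))"
      by (rule sum.swap)
    also have "\<dots> = entry (A * (B * C)) i j"
      by (simp add: entry_times[OF N(1)] entry_times[OF N(2)] sum_distrib_left)
    finally show "entry (A * B * C) i j = entry (A * (B * C)) i j" .
  qed
  show "(A + B) * C = A * C + B * C" "A * (B + C) = A * B + A * C"
    by (auto intro!: fmat_eqI simp: entry_times[OF N(1)] entry_times[OF N(2)] entry_times[OF N(4)]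
        plus_fmat.rep_eq algebra_simps sum.distrib)
qed

end

lemmas entry_simps = plus_fmat.rep_eq zero_fmat.rep_eq uminus_fmat.rep_eq

lemma entry_minus [simp]: "entry (A - B) i j = entry A i j - entry B i j"
  unfolding minus_fmat_def plus_fmat.rep_eq uminus_fmat.rep_eq by simp

instantiation fmat :: real_inner
begin

lift_definition scaleR_fmat :: "real \<Rightarrow> fmat \<Rightarrow> fmat" is "\<lambda>c f i j. c * f i j"
  by auto

lift_definition inner_fmat :: "fmat \<Rightarrow> fmat \<Rightarrow> real"
  is "\<lambda>f g. \<Sum>p | f (fst p) (snd p) \<noteq> 0. f (fst p) (snd p) * g (fst p) (snd p)" .

definition norm_fmat :: "fmat \<Rightarrow> real" where "norm_fmat A = sqrt (inner A A)"
definition dist_fmat :: "fmat \<Rightarrow> fmat \<Rightarrow> real" where "dist_fmat A B = norm (A - B)"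
definition sgn_fmat :: "fmat \<Rightarrow> fmat" where "sgn_fmat A = inverse (norm A) *\<^sub>R A"
definition uniformity_fmat :: "(fmat \<times> fmat) filter" where
  "uniformity_fmat = (INF e\<in>{0<..}. principal {(x, y). dist x y < e})"
definition open_fmat :: "fmat set \<Rightarrow> bool" where
  "open_fmat U \<longleftrightarrow> (\<forall>x\<in>U. eventually (\<lambda>(x', y). x' = x \<longrightarrow> y \<in> U) uniformity)"

lemma inner_fmat_eq:
  assumes "supported N A"
  shows "inner A B = (\<Sum>i<N. \<Sum>j<N. entry A i j * entry B i j)"
proof -
  have "inner A B = (\<Sum>p\<in>{..<N} \<times> {..<N}. entry A (fst p) (snd p) * entry B (fst p) (snd p))"
    unfolding inner_fmat.rep_eq using assms
    by (intro sum_nonzero_eq) (simp, metis supported_def mem_Times_iff lessThan_iff not_le)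
  then show ?thesis by (simp add: sum.cartesian_product split_beta)
qed

instance
proof
  fix A B C :: fmat and a b :: real
  obtain N where "\<forall>D\<in>{A, B, A + B, a *\<^sub>R A}. supported N D"
    using common_support by (metis finite.emptyI finite.insertI)
  then have N: "supported N A" "supported N B" "supported N (A + B)" "supported N (a *\<^sub>R A)" by auto
  note I = inner_fmat_eq[OF N(1)] inner_fmat_eq[OF N(2)] inner_fmat_eq[OF N(3)] inner_fmat_eq[OF N(4)]
  show "a *\<^sub>R (A + B) = a *\<^sub>R A + a *\<^sub>R B" "(a + b) *\<^sub>R A = a *\<^sub>R A + b *\<^sub>R A"
    "a *\<^sub>R b *\<^sub>R A = (a * b) *\<^sub>R A" "1 *\<^sub>R A = A"
    by (auto intro!: fmat_eqI simp: scaleR_fmat.rep_eq entry_simps algebra_simps)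
  show "inner A B = inner B A" by (simp add: I mult.commute)
  show "inner (A + B) C = inner A C + inner B C"
    by (simp add: I entry_simps algebra_simps sum.distrib)
  show "inner (a *\<^sub>R A) B = a * inner A B"
    by (simp add: I scaleR_fmat.rep_eq sum_distrib_left mult.assoc)
  show "0 \<le> inner A A" by (simp add: I sum_nonneg)
  show "inner A A = 0 \<longleftrightarrow> A = 0"
  proof
    assume "inner A A = 0"
    then have "\<forall>i<N. \<forall>j<N. entry A i j = 0"
      by (simp add: I sum_nonneg_eq_0_iff sum_nonneg)
    with N(1) show "A = 0"
      by (intro fmat_eqI) (metis not_le supported_def zero_fmat.rep_eq)
  next
    assume "A = 0"
    then have "entry A i j = 0" for i j by (simp add: entry_simps)
    then show "inner A A = 0" by (simp add: I)
  qed
qed (simp_all add: norm_fmat_def dist_fmat_def sgn_fmat_def uniformity_fmat_def open_fmat_def)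

end

text \<open>Cauchy-Schwarz for each row against each column makes the Frobenius norm
  submultiplicative. There is no unit, since the infinite identity is not finitely
  supported.\<close>

instance fmat :: real_normed_algebra
proof
  fix A B :: fmat and a :: real
  obtain N where "\<forall>D\<in>{A, B, a *\<^sub>R A}. supported N D"
    using common_support by (metis finite.emptyI finite.insertI)
  then have N: "supported N A" "supported N B" "supported N (a *\<^sub>R A)" by auto
  show "a *\<^sub>R A * B = a *\<^sub>R (A * B)" "A * a *\<^sub>R B = a *\<^sub>R (A * B)"
    by (auto intro!: fmat_eqI simp: entry_times[OF N(1)] entry_times[OF N(3)] scaleR_fmat.rep_eq
        sum_distrib_left ac_simps)
  have "inner (A * B) (A * B) = (\<Sum>i<N. \<Sum>j<N. (\<Sum>k<N. entry A i k * entry B k j)\<^sup>2)"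
    by (simp add: inner_fmat_eq[OF supported_times[OF N(1,2)]] entry_times[OF N(1)] power2_eq_square)
  also have "\<dots> \<le> (\<Sum>i<N. \<Sum>j<N. (\<Sum>k<N. (entry A i k)\<^sup>2) * (\<Sum>k<N. (entry B k j)\<^sup>2))"
    by (intro sum_mono Cauchy_Schwarz_ineq_sum)
  also have "\<dots> = inner A A * (\<Sum>j<N. \<Sum>k<N. (entry B k j)\<^sup>2)"
    by (simp add: inner_fmat_eq[OF N(1)] power2_eq_square sum_product)
  also have "\<dots> = inner A A * inner B B"
    by (subst sum.swap) (simp add: inner_fmat_eq[OF N(2)] power2_eq_square)
  finally show "norm (A * B) \<le> norm A * norm B"
    by (simp add: norm_fmat_def flip: real_sqrt_mult)
qed

lift_definition tp :: "fmat \<Rightarrow> fmat" is "\<lambda>f i j. f j i" by blast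

lemma tp_tp [simp]: "tp (tp A) = A"
  and tp_add [simp]: "tp (A + B) = tp A + tp B"
  and tp_diff [simp]: "tp (A - B) = tp A - tp B"
  and tp_minus [simp]: "tp (- A) = - tp A"
  and tp_scaleR [simp]: "tp (c *\<^sub>R A) = c *\<^sub>R tp A"
  by (auto intro!: fmat_eqI simp: tp.rep_eq entry_simps scaleR_fmat.rep_eq)

lemma supported_tp [simp]: "supported N (tp A) \<longleftrightarrow> supported N A"
  by (auto simp: supported_def tp.rep_eq)

lemma tp_mult [simp]: "tp (A * B) = tp B * tp A"
proof -
  obtain N where "\<forall>D\<in>{A, B}. supported N D"
    using common_support by (metis finite.emptyI finite.insertI)
  then have N: "supported N A" "supported N (tp B)" by auto
  show ?thesis
    by (rule fmat_eqI) (simp add: tp.rep_eq entry_times[OF N(1)] entry_times[OF N(2)] mult.commute)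
qed

lemma inner_tp_tp [simp]: "inner (tp A) (tp B) = inner A B"
proof -
  obtain N where "\<forall>D\<in>{A}. supported N D"
    using common_support by (metis finite.emptyI finite.insertI)
  then have N: "supported N A" "supported N (tp A)" by auto
  show ?thesis
    by (simp add: inner_fmat_eq[OF N(1)] inner_fmat_eq[OF N(2)] tp.rep_eq) (rule sum.swap)
qed

text \<open>Cyclicity of the trace: both sides are tr(B^T A^T C). With the companion rule for the
  right factor it replaces all explicit traces.\<close>

lemma inner_times_left: "inner (A * B) C = inner B (tp A * C)"
proof -
  obtain N where "\<forall>D\<in>{A, B, C}. supported N D"
    using common_support by (metis finite.emptyI finite.insertI)
  then have N: "supported N A" "supported N B" "supported N C" "supported N (tp A)" by auto
  have "inner (A * B) C = (\<Sum>i<N. \<Sum>j<N. \<Sum>k<N. entry A i k * entry B k j * entry C i j)"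
    by (simp add: inner_fmat_eq[OF supported_times[OF N(1,2)]] entry_times[OF N(1)] sum_distrib_right)
  also have "\<dots> = (\<Sum>i<N. \<Sum>k<N. \<Sum>j<N. entry A i k * entry B k j * entry C i j)"
    by (intro sum.cong refl sum.swap)
  also have "\<dots> = (\<Sum>k<N. \<Sum>i<N. \<Sum>j<N. entry A i k * entry B k j * entry C i j)"
    by (rule sum.swap)
  also have "\<dots> = (\<Sum>k<N. \<Sum>j<N. \<Sum>i<N. entry A i k * entry B k j * entry C i j)"
    by (intro sum.cong refl sum.swap)
  also have "\<dots> = inner B (tp A * C)"
    by (simp add: inner_fmat_eq[OF N(2)] entry_times[OF N(4)] tp.rep_eq sum_distrib_left ac_simps)
  finally show ?thesis .
qed

lemma inner_times_right: "inner (A * B) C = inner A (C * tp B)"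
  using inner_times_left[of "tp B" "tp A" "tp C"] by (metis inner_tp_tp tp_mult tp_tp)

lemma norm_tp [simp]: "norm (tp A) = norm A"
  by (simp add: norm_fmat_def)

section \<open>Error estimates near the balanced factorization\<close>

lemma sum_squared_le:
  fixes x y :: real
  shows "(x + y)\<^sup>2 \<le> 2 * x\<^sup>2 + 2 * y\<^sup>2"
  using sum_squares_bound[of x y] by (simp add: power2_sum)

lemma norm_mult_squared: "(norm (A * B))\<^sup>2 = inner A (A * (B * tp B))" for A B :: fmat
  by (simp add: power2_norm_eq_inner inner_times_right mult.assoc)

text \<open>An upper bound on the spectral norm, phrased through the Frobenius norm. Bounding the
  factors by their own Frobenius norm would bring the rank into the constants.\<close>

definition op_bound :: "fmat \<Rightarrow> real \<Rightarrow> bool" where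
  "op_bound A c \<longleftrightarrow> 0 \<le> c \<and> (\<forall>G. norm (A * G) \<le> c * norm G)"

lemma op_bound_left: "op_bound A c \<Longrightarrow> norm (A * G) \<le> c * norm G"
  by (simp add: op_bound_def)

text \<open>The square |A^T G|^2 = <G, A A^T G> contains |A^T G| once more after the bound for A is
  applied, and this factor cancels.\<close>

lemma op_bound_tp:
  assumes "op_bound A c"
  shows "op_bound (tp A) c"
  unfolding op_bound_def
proof (intro conjI allI)
  fix G
  have "(norm (tp A * G))\<^sup>2 = inner G (A * (tp A * G))"
    by (simp add: power2_norm_eq_inner inner_times_left)
  also have "\<dots> \<le> norm G * norm (A * (tp A * G))"
    by (rule norm_cauchy_schwarz)
  also have "\<dots> \<le> norm G * (c * norm (tp A * G))"
    by (intro mult_left_mono op_bound_left assms) simp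
  finally have "norm (tp A * G) * norm (tp A * G) \<le> (c * norm G) * norm (tp A * G)"
    by (simp add: power2_eq_square ac_simps)
  then show "norm (tp A * G) \<le> c * norm G"
    using assms by (cases "norm (tp A * G) = 0") (auto simp: op_bound_def mult_le_cancel_right)
qed (use assms in \<open>simp add: op_bound_def\<close>)

lemma op_bound_right:
  assumes "op_bound A c"
  shows "norm (G * A) \<le> c * norm G"
  using op_bound_left[OF op_bound_tp[OF assms], of "tp G"] by (metis norm_tp tp_mult)

lemma op_bound_perturb:
  assumes "op_bound A c" "norm (B - A) \<le> d"
  shows "op_bound B (c + d)"
  unfolding op_bound_def
proof (intro conjI allI)
  show "0 \<le> c + d"
    using assms norm_ge_zero[of "B - A"] unfolding op_bound_def by linarith
  fix G
  have "norm (B * G) \<le> norm (A * G) + norm ((B - A) * G)"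
    by (metis add_diff_cancel_left' add.commute diff_add_cancel left_diff_distrib norm_triangle_ineq)
  also have "\<dots> \<le> c * norm G + d * norm G"
    by (intro add_mono op_bound_left assms order_trans[OF norm_mult_ineq] mult_right_mono) simp
  finally show "norm (B * G) \<le> (c + d) * norm G" by (simp add: distrib_right)
qed

text \<open>The ground truth without dimensions: \<open>\<alpha>\<close> and \<open>\<beta>\<close>
  are bounds for the singular values of both factors, later the square roots of \<sigma>_min and
  \<sigma>_max. The projection \<open>e\<close> is the identity of size r; the lower bound is stated
  with \<open>e * G\<close> because \<open>Xs\<close> annihilates everything outside this
  corner.\<close>

locale balanced_factors =
  fixes Xs Ys e :: fmat and \<alpha> \<beta> :: real
  assumes tp_e: "tp e = e" and Xs_e: "Xs * e = Xs" and Ys_e: "Ys * e = Ys" and e_e: "e * e = e"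
    and \<alpha>_pos: "0 < \<alpha>" and \<alpha>_le_\<beta>: "\<alpha> \<le> \<beta>"
    and balanced: "tp Xs * Xs = tp Ys * Ys"
    and lower_Xs: "\<alpha> * norm (e * G) \<le> norm (Xs * G)"
    and upper_Xs: "norm (Xs * G) \<le> \<beta> * norm G"
begin

lemma \<beta>_pos: "0 < \<beta>"
  using \<alpha>_pos \<alpha>_le_\<beta> by linarith

lemma norm_Ys: "norm (Ys * G) = norm (Xs * G)"
proof -
  have "(norm (Ys * G))\<^sup>2 = inner G ((tp Ys * Ys) * G)"
    by (simp add: power2_norm_eq_inner inner_times_left mult.assoc)
  also have "\<dots> = (norm (Xs * G))\<^sup>2"
    by (simp add: power2_norm_eq_inner inner_times_left mult.assoc flip: balanced)
  finally show ?thesis by simp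
qed

lemma op_bound_Xs: "op_bound Xs \<beta>" and op_bound_Ys: "op_bound Ys \<beta>"
  using upper_Xs norm_Ys \<beta>_pos by (auto simp: op_bound_def)

lemma lower_Ys: "\<alpha> * norm (e * G) \<le> norm (Ys * G)"
  using lower_Xs norm_Ys by simp

definition err :: "fmat \<Rightarrow> fmat \<Rightarrow> real" where
  "err X Y = (norm (X - Xs))\<^sup>2 + (norm (Y - Ys))\<^sup>2"

text \<open>Half the gradient of \<open>err\<close> along the alignments P = I + T at T = 0, where
  P^{-T} = I - T^T to first order.\<close>

definition gauge :: "fmat \<Rightarrow> fmat \<Rightarrow> fmat" where
  "gauge X Y = tp X * (X - Xs) - tp (Y - Ys) * Y"

definition residual :: "fmat \<Rightarrow> fmat \<Rightarrow> fmat" where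
  "residual X Y = X * tp Y - Xs * tp Ys"

definition imbalance :: "fmat \<Rightarrow> fmat \<Rightarrow> fmat" where
  "imbalance X Y = tp X * X - tp Y * Y"

text \<open>\<open>gl P Q\<close>: the corner of \<open>P\<close> is invertible with inverse \<open>Q\<close>; the idempotent \<open>e\<close> plays the role of \<open>I\<^sub>r\<close>.\<close>

definition gl :: "fmat \<Rightarrow> fmat \<Rightarrow> bool" where
  "gl P Q \<longleftrightarrow> e * P = P \<and> P * e = P \<and> e * Q = Q \<and> Q * e = Q \<and> P * Q = e \<and> Q * P = e"

lemma err_nonneg: "0 \<le> err X Y"
  by (simp add: err_def)

lemma norm_le_sqrt_err: "norm (X - Xs) \<le> sqrt (err X Y)" "norm (Y - Ys) \<le> sqrt (err X Y)"
  by (auto simp: err_def intro!: real_le_rsqrt)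

lemma mult_norms_le_err: "norm (X - Xs) * norm (Y - Ys) \<le> err X Y / 2"
  using sum_squares_bound[of "norm (X - Xs)" "norm (Y - Ys)"] by (simp add: err_def)

lemma op_bound_X:
  assumes "sqrt (err X Y) \<le> \<alpha> / 10"
  shows "op_bound X (11 / 10 * \<beta>)" "op_bound Y (11 / 10 * \<beta>)"
proof -
  have "norm (X - Xs) \<le> \<beta> / 10" "norm (Y - Ys) \<le> \<beta> / 10"
    using assms norm_le_sqrt_err[of X Y] norm_le_sqrt_err[where X=X and Y=Y] \<alpha>_le_\<beta> by linarith+
  then show "op_bound X (11 / 10 * \<beta>)" "op_bound Y (11 / 10 * \<beta>)"
    using op_bound_perturb[OF op_bound_Xs, of X "\<beta> / 10"] op_bound_perturb[OF op_bound_Ys, of Y "\<beta> / 10"]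
    by simp_all
qed

lemma lower_Y:
  assumes "sqrt (err X Y) \<le> \<alpha> / 10" "Y * e = Y"
  shows "9 / 10 * \<alpha> * norm (e * G) \<le> norm (Y * G)"
proof -
  have d: "norm (Y - Ys) \<le> \<alpha> / 10"
    using assms(1) norm_le_sqrt_err(2)[where X=X and Y=Y] by linarith
  have "Ys * G = Y * G - (Y - Ys) * (e * G)"
    using assms(2) Ys_e by (simp add: algebra_simps flip: mult.assoc)
  then have "norm (Ys * G) \<le> norm (Y * G) + norm ((Y - Ys) * (e * G))"
    by (metis norm_triangle_ineq4)
  also have "norm ((Y - Ys) * (e * G)) \<le> \<alpha> / 10 * norm (e * G)"
    by (intro order_trans[OF norm_mult_ineq] mult_right_mono d) simp
  finally show ?thesis using lower_Ys[of G] by linarith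
qed

section \<open>Lower and upper bounds for the residual\<close>

lemma err_small_sq:
  assumes "sqrt (err X Y) \<le> \<alpha> / 10"
  shows "err X Y \<le> \<alpha>\<^sup>2 / 100"
  using power_mono[OF assms, of 2] err_nonneg by (simp add: power_divide)

text \<open>The linear part L of the residual vanishes along the symmetry directions dx =
  \<open>Xs\<close> Z, dy = - \<open>Ys\<close> Z^T, so a bound by the error alone is impossible.
  Expanding |L|^2 leaves the cross term 2 <A, B>, and A - B is the gauge defect up to second order
  in the error. The cross term therefore costs only the square of the gauge defect and terms of
  fourth order.\<close>

lemma residual_lower:
  assumes small: "sqrt (err X Y) \<le> \<alpha> / 10" and X_e: "X * e = X" and Y_e: "Y * e = Y"
  shows "12 / 25 * \<alpha>\<^sup>2 * err X Y - (norm (gauge X Y))\<^sup>2 \<le> (norm (residual X Y))\<^sup>2"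
proof -
  define dx dy where "dx = X - Xs" and "dy = Y - Ys"
  have X: "X = Xs + dx" and Y: "Y = Ys + dy" by (simp_all add: dx_def dy_def)
  define s g where "s = err X Y" and "g = norm (gauge X Y)"
  have s: "s = (norm dx)\<^sup>2 + (norm dy)\<^sup>2" by (simp add: s_def err_def dx_def dy_def)
  define A B where "A = tp Xs * dx" and "B = tp dy * Ys"
  define L where "L = Xs * tp dy + dx * tp Ys"
  have A_B: "A - B = gauge X Y - tp dx * dx + tp dy * dy"
    unfolding A_def B_def gauge_def dx_def dy_def by (simp add: algebra_simps)
  have "norm (A - B) \<le> norm (gauge X Y) + norm (tp dx * dx) + norm (tp dy * dy)"
    unfolding A_B using norm_triangle_ineq[of "gauge X Y - tp dx * dx" "tp dy * dy"]
      norm_triangle_ineq4[of "gauge X Y" "tp dx * dx"] by linarith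
  also have "norm (tp dx * dx) \<le> (norm dx)\<^sup>2"
    using norm_mult_ineq[of "tp dx" dx] by (simp add: power2_eq_square)
  also have "norm (tp dy * dy) \<le> (norm dy)\<^sup>2"
    using norm_mult_ineq[of "tp dy" dy] by (simp add: power2_eq_square)
  finally have AB: "norm (A - B) \<le> g + s" by (simp add: g_def s)
  have AB2: "(norm (A - B))\<^sup>2 \<le> 2 * g\<^sup>2 + 2 * s\<^sup>2"
    using power_mono[OF AB, of 2] sum_squared_le[of g s] by simp
  have "inner (Xs * tp dy) (dx * tp Ys) = inner (tp dy) (A * tp Ys)"
    unfolding A_def by (simp add: inner_times_left mult.assoc)
  also have "\<dots> = inner B A"
    using inner_times_right[of A "tp Ys" "tp dy"] unfolding B_def by (simp add: inner_commute)
  finally have "inner (Xs * tp dy) (dx * tp Ys) = inner B A" .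
  then have "(norm L)\<^sup>2 = (norm (Xs * tp dy))\<^sup>2 + (norm (dx * tp Ys))\<^sup>2 + 2 * inner A B"
    unfolding L_def by (simp add: power2_norm_eq_inner inner_add inner_commute)
  moreover have "(\<alpha> * norm dy)\<^sup>2 \<le> (norm (Xs * tp dy))\<^sup>2"
  proof (rule power_mono)
    have "e * tp dy = tp dy"
      by (metis Y_e Ys_e dy_def left_diff_distrib tp_e tp_mult)
    then show "\<alpha> * norm dy \<le> norm (Xs * tp dy)" using lower_Xs[of "tp dy"] by simp
  qed (use \<alpha>_pos in simp)
  moreover have "(\<alpha> * norm dx)\<^sup>2 \<le> (norm (dx * tp Ys))\<^sup>2"
  proof (rule power_mono)
    have "e * tp dx = tp dx"
      by (metis X_e Xs_e dx_def left_diff_distrib tp_e tp_mult)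
    moreover have "norm (dx * tp Ys) = norm (Ys * tp dx)"
      by (metis norm_tp tp_mult tp_tp)
    ultimately show "\<alpha> * norm dx \<le> norm (dx * tp Ys)" using lower_Ys[of "tp dx"] by simp
  qed (use \<alpha>_pos in simp)
  \<comment> \<open>The difference of the two sides is |A|^2 + |B|^2. Only A - B is known to be
    small, not A or B.\<close>
  moreover have "- 2 * inner A B \<le> (norm (A - B))\<^sup>2"
    using inner_ge_zero[of A] inner_ge_zero[of B]
    by (simp add: power2_norm_eq_inner inner_diff inner_commute)
  ultimately have L: "\<alpha>\<^sup>2 * s - 2 * g\<^sup>2 - 2 * s\<^sup>2 \<le> (norm L)\<^sup>2"
    using AB2 by (simp add: s power_mult_distrib distrib_left)
  have E: "residual X Y = L + dx * tp dy"
    unfolding residual_def L_def dx_def dy_def by (simp add: algebra_simps)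
  have "norm L \<le> norm (residual X Y) + norm (dx * tp dy)"
    unfolding E by (metis add_diff_cancel_right' norm_triangle_ineq4)
  also have "norm (dx * tp dy) \<le> s / 2"
    using norm_mult_ineq[of dx "tp dy"] mult_norms_le_err[of X Y]
    unfolding norm_tp dx_def[symmetric] dy_def[symmetric] s_def[symmetric] by linarith
  finally have "norm L \<le> norm (residual X Y) + s / 2" by simp
  from power_mono[OF this, of 2] have "(norm L)\<^sup>2 \<le> 2 * (norm (residual X Y))\<^sup>2 + 2 * (s / 2)\<^sup>2"
    using sum_squared_le[of "norm (residual X Y)" "s / 2"] by simp
  moreover have "s\<^sup>2 \<le> \<alpha>\<^sup>2 * s / 100"
    using mult_right_mono[OF err_small_sq[OF small] err_nonneg[of X Y]] by (simp add: s_def power2_eq_square)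
  \<comment> \<open>With s^2 at most \<alpha>^2 s / 100 the coefficient of \<alpha>^2 s is (1 -
    2/100 - 1/200) / 2, which exceeds 12/25; the halving comes from splitting L into the residual
    and the quadratic term.\<close>
  ultimately show ?thesis
    using L mult_nonneg_nonneg[OF zero_le_power2[of \<alpha>] err_nonneg[of X Y]]
    unfolding s_def[symmetric] g_def[symmetric] by (simp add: power_divide)
qed

lemma residual_upper:
  assumes small: "sqrt (err X Y) \<le> \<alpha> / 10"
  shows "(norm (residual X Y))\<^sup>2 \<le> 5 * \<beta>\<^sup>2 * err X Y"
proof -
  define u v where "u = norm (X - Xs)" and "v = norm (Y - Ys)"
  have "residual X Y = (X - Xs) * tp Y + Xs * tp (Y - Ys)"
    unfolding residual_def by (simp add: algebra_simps)
  then have "norm (residual X Y) \<le> norm ((X - Xs) * tp Y) + norm (Xs * tp (Y - Ys))"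
    by (metis norm_triangle_ineq)
  also have "norm ((X - Xs) * tp Y) \<le> 11 / 10 * \<beta> * u"
    unfolding u_def by (intro op_bound_right op_bound_tp op_bound_X(2)[OF small])
  also have "norm (Xs * tp (Y - Ys)) \<le> \<beta> * v"
    using op_bound_left[OF op_bound_Xs, of "tp (Y - Ys)"] unfolding v_def norm_tp .
  finally have "norm (residual X Y) \<le> 11 / 10 * \<beta> * u + \<beta> * v" by simp
  from power_mono[OF this, of 2]
  have "(norm (residual X Y))\<^sup>2 \<le> 2 * (11 / 10 * \<beta> * u)\<^sup>2 + 2 * (\<beta> * v)\<^sup>2"
    using sum_squared_le[of "11 / 10 * \<beta> * u" "\<beta> * v"] by simp
  also have "\<dots> \<le> 5 * (\<beta>\<^sup>2 * u\<^sup>2) + 5 * (\<beta>\<^sup>2 * v\<^sup>2)"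
    by (simp add: power_mult_distrib power_divide)
  also have "\<dots> = 5 * \<beta>\<^sup>2 * err X Y"
    by (simp add: err_def u_def v_def algebra_simps)
  finally show ?thesis .
qed


section \<open>The gauge defect as a descent direction\<close>

lemma gauge_upper:
  assumes small: "sqrt (err X Y) \<le> \<alpha> / 10"
  shows "norm (gauge X Y) \<le> \<beta>\<^sup>2 / 4"
proof -
  have dx: "norm (X - Xs) \<le> \<beta> / 10" and dy: "norm (Y - Ys) \<le> \<beta> / 10"
    using small norm_le_sqrt_err[of X Y] norm_le_sqrt_err[where X=X and Y=Y] \<alpha>_le_\<beta> by linarith+
  have "norm (gauge X Y) \<le> norm (tp X * (X - Xs)) + norm (tp (Y - Ys) * Y)"
    unfolding gauge_def by (rule norm_triangle_ineq4)
  also have "norm (tp X * (X - Xs)) \<le> 11 / 10 * \<beta> * norm (X - Xs)"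
    by (intro op_bound_left op_bound_tp op_bound_X[OF small])
  also have "\<dots> \<le> 11 / 10 * \<beta> * (\<beta> / 10)"
    using dx \<beta>_pos by (intro mult_left_mono) auto
  also have "norm (tp (Y - Ys) * Y) \<le> 11 / 10 * \<beta> * norm (tp (Y - Ys))"
    by (intro op_bound_right op_bound_X[OF small])
  also have "\<dots> \<le> 11 / 10 * \<beta> * (\<beta> / 10)"
    unfolding norm_tp using dy \<beta>_pos by (intro mult_left_mono) auto
  finally have "norm (gauge X Y) \<le> 22 / 100 * \<beta>\<^sup>2" by (simp add: power2_eq_square)
  also have "\<dots> \<le> \<beta>\<^sup>2 / 4" by simp
  finally show ?thesis .
qed

lemma gauge_descent:
  assumes small: "sqrt (err X Y) \<le> \<alpha> / 10" and X_e: "X * e = X" and Y_e: "Y * e = Y"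
    and inverse: "\<And>G. e * G = G \<Longrightarrow> G * e = G \<Longrightarrow> norm G \<le> 1 / 2 \<Longrightarrow> \<exists>H. gl (e + G) H"
  obtains P Q where "gl P Q"
    "err (X * P) (Y * tp Q) \<le> err X Y - (norm (gauge X Y))\<^sup>2 / (7 * \<beta>\<^sup>2)"
proof -
  define dx dy where "dx = X - Xs" and "dy = Y - Ys"
  define \<Gamma> where "\<Gamma> = gauge X Y"
  define T where "T = - (1 / (7 * \<beta>\<^sup>2)) *\<^sub>R \<Gamma>"
  have \<beta>2: "0 < \<beta>\<^sup>2" using \<beta>_pos by simp
  have "e * \<Gamma> = \<Gamma>" "\<Gamma> * e = \<Gamma>"
  proof -
    have "e * tp X = tp X" "e * tp dy = tp dy" "dx * e = dx"
      using X_e Y_e Xs_e Ys_e tp_e by (metis dx_def dy_def left_diff_distrib tp_mult)+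
    then show "e * \<Gamma> = \<Gamma>" "\<Gamma> * e = \<Gamma>"
      unfolding \<Gamma>_def gauge_def dx_def[symmetric] dy_def[symmetric]
      by (simp_all add: left_diff_distrib right_diff_distrib mult.assoc Y_e flip: mult.assoc[of e])
  qed
  then have T_e: "e * T = T" "T * e = T" by (simp_all add: T_def)
  have nT: "norm T = norm \<Gamma> / (7 * \<beta>\<^sup>2)" by (simp add: T_def)
  have "norm \<Gamma> \<le> 1 / 2 * (7 * \<beta>\<^sup>2)"
    using gauge_upper[OF small] \<beta>2 unfolding \<Gamma>_def by linarith
  then have "norm T \<le> 1 / 2"
    unfolding nT using \<beta>2 by (simp add: pos_divide_le_eq)
  with inverse T_e obtain H where H: "gl (e + T) H" by blast
  define J where "J = T * H"
  \<comment> \<open>The exact inverse is e - J with J = T H. The recursion J = T - T J gives |J|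
    \<le> 2 |T| directly from |T| \<le> 1/2, and T J is the second order part of J.\<close>
  have He: "H = e - J"
    using H by (simp add: gl_def J_def distrib_right) (metis add_diff_cancel_right')
  then have "T * H = T * (e - J)" by simp
  then have J: "J = T - T * J"
    using T_e(2) by (simp add: right_diff_distrib flip: J_def)
  have nTJ: "norm (T * J) \<le> norm T * norm J" by (rule norm_mult_ineq)
  have "norm J \<le> norm T + norm (T * J)"
    using J norm_triangle_ineq4 by metis
  also have "norm (T * J) \<le> 1 / 2 * norm J"
    using nTJ mult_right_mono[OF \<open>norm T \<le> 1 / 2\<close> norm_ge_zero[of J]] by linarith
  finally have nJ: "norm J \<le> 2 * norm T" by simp
  have nTJ2: "norm (T * J) \<le> 2 * (norm T)\<^sup>2"
    using nTJ mult_left_mono[OF nJ norm_ge_zero[of T]] by (simp add: power2_eq_square)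
  have XT: "X * (e + T) - Xs = dx + X * T"
    by (simp add: dx_def distrib_left X_e)
  have YH: "Y * tp H - Ys = dy - Y * tp J"
    by (simp add: dy_def He right_diff_distrib tp_e Y_e)
  have i1: "inner dx (X * T) = inner (tp X * dx) T"
    by (simp add: inner_times_left)
  have i2: "inner dy (Y * tp T) = inner (tp dy * Y) T"
    by (simp add: inner_times_left inner_times_right)
       (metis inner_commute inner_times_left inner_times_right tp_tp)
  have "inner dy (Y * tp J) = inner dy (Y * tp T) - inner dy (Y * tp (T * J))"
    by (subst J) (simp add: right_diff_distrib inner_diff)
  then have "err (X * (e + T)) (Y * tp H)
      = err X Y + 2 * inner \<Gamma> T + (norm (X * T))\<^sup>2 + 2 * inner dy (Y * tp (T * J)) + (norm (Y * tp J))\<^sup>2"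
    unfolding err_def XT YH \<Gamma>_def gauge_def
    using i1 i2 by (simp add: power2_norm_eq_inner inner_add inner_diff inner_commute flip: dx_def dy_def)
  also have "(norm (X * T))\<^sup>2 \<le> (11 / 10 * \<beta> * norm T)\<^sup>2"
    by (intro power_mono op_bound_left op_bound_X[OF small]) simp
  also have "(norm (Y * tp J))\<^sup>2 \<le> (11 / 10 * \<beta> * (2 * norm T))\<^sup>2"
  proof (intro power_mono)
    have "norm (Y * tp J) \<le> 11 / 10 * \<beta> * norm (tp J)"
      by (intro op_bound_left op_bound_X[OF small])
    also have "\<dots> \<le> 11 / 10 * \<beta> * (2 * norm T)"
      using nJ \<beta>_pos by (intro mult_left_mono) auto
    finally show "norm (Y * tp J) \<le> 11 / 10 * \<beta> * (2 * norm T)" .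
  qed simp
  also have "inner dy (Y * tp (T * J)) \<le> \<beta> / 10 * (11 / 10 * \<beta> * (2 * (norm T)\<^sup>2))"
  proof -
    have "inner dy (Y * tp (T * J)) \<le> norm dy * norm (Y * tp (T * J))"
      by (rule norm_cauchy_schwarz)
    also have "\<dots> \<le> \<beta> / 10 * (11 / 10 * \<beta> * (2 * (norm T)\<^sup>2))"
    proof (intro mult_mono)
      show "norm dy \<le> \<beta> / 10"
        using small norm_le_sqrt_err(2)[where X=X and Y=Y] \<alpha>_le_\<beta> unfolding dy_def by linarith
      have "norm (Y * tp (T * J)) \<le> 11 / 10 * \<beta> * norm (tp (T * J))"
        by (intro op_bound_left op_bound_X[OF small])
      also have "\<dots> \<le> 11 / 10 * \<beta> * (2 * (norm T)\<^sup>2)"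
        unfolding norm_tp using nTJ2 \<beta>_pos by (intro mult_left_mono) auto
      finally show "norm (Y * tp (T * J)) \<le> 11 / 10 * \<beta> * (2 * (norm T)\<^sup>2)" .
    qed (use \<beta>_pos in auto)
    finally show ?thesis .
  qed
  \<comment> \<open>The second order terms add up to 121/100 + 484/100 + 44/100 < 7 times \<beta>^2
    |T|^2. For the step size 1 / (7 \<beta>^2) they consume exactly half of the first order
    gain.\<close>
  finally have "err (X * (e + T)) (Y * tp H) \<le> err X Y + 2 * inner \<Gamma> T + 7 * (\<beta>\<^sup>2 * (norm T)\<^sup>2)"
    using mult_nonneg_nonneg[OF less_imp_le[OF \<beta>2] zero_le_power2[of "norm T"]]
    by (simp add: power_mult_distrib power_divide power2_eq_square algebra_simps)
  also have "\<beta>\<^sup>2 * (norm T)\<^sup>2 = (norm \<Gamma>)\<^sup>2 / (49 * \<beta>\<^sup>2)"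
    using \<beta>2 by (simp add: nT power_divide power_mult_distrib power2_eq_square)
  also have "inner \<Gamma> T = - (norm \<Gamma>)\<^sup>2 / (7 * \<beta>\<^sup>2)"
    by (simp add: T_def power2_norm_eq_inner)
  finally have "err (X * (e + T)) (Y * tp H) \<le> err X Y - (norm \<Gamma>)\<^sup>2 / (7 * \<beta>\<^sup>2)"
    by (simp add: field_simps)
  with H that show thesis unfolding \<Gamma>_def by blast
qed

section \<open>Imbalance controls the Gram matrix of the alignment\<close>

lemma imbalance_upper:
  assumes small: "sqrt (err X Y) \<le> \<alpha> / 10"
  shows "norm (imbalance X Y) \<le> 21 / 5 * \<beta> * sqrt (err X Y)"
proof -
  have 1: "norm (tp Z * Z - tp Zs * Zs) \<le> 21 / 10 * \<beta> * sqrt (err X Y)"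
    if "op_bound Z (11 / 10 * \<beta>)" "op_bound Zs \<beta>" "norm (Z - Zs) \<le> sqrt (err X Y)" for Z Zs
  proof -
    have "tp Z * Z - tp Zs * Zs = tp Z * (Z - Zs) + tp (Z - Zs) * Zs"
      by (simp add: algebra_simps)
    then have "norm (tp Z * Z - tp Zs * Zs) \<le> norm (tp Z * (Z - Zs)) + norm (tp (Z - Zs) * Zs)"
      by (metis norm_triangle_ineq)
    also have "norm (tp Z * (Z - Zs)) \<le> 11 / 10 * \<beta> * norm (Z - Zs)"
      by (intro op_bound_left op_bound_tp that)
    also have "norm (tp (Z - Zs) * Zs) \<le> \<beta> * norm (Z - Zs)"
      using op_bound_right[OF that(2), of "tp (Z - Zs)"] unfolding norm_tp .
    finally have "norm (tp Z * Z - tp Zs * Zs) \<le> 21 / 10 * \<beta> * norm (Z - Zs)" by simp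
    also have "\<dots> \<le> 21 / 10 * \<beta> * sqrt (err X Y)"
      using \<beta>_pos that by (intro mult_left_mono) auto
    finally show ?thesis .
  qed
  have "imbalance X Y = (tp X * X - tp Xs * Xs) - (tp Y * Y - tp Ys * Ys)"
    by (simp add: imbalance_def balanced)
  then have "norm (imbalance X Y) \<le> norm (tp X * X - tp Xs * Xs) + norm (tp Y * Y - tp Ys * Ys)"
    by (metis norm_triangle_ineq4)
  with 1[of X Xs] 1[of Y Ys] show ?thesis
    using op_bound_X[OF small] op_bound_Xs op_bound_Ys norm_le_sqrt_err[of X Y] norm_le_sqrt_err(2)[of Y X]
    by simp
qed

text \<open>Here X and Y are the aligned factors, and X Q, Y P^T are the iterates themselves. The
  estimate is not perturbative: K = P^T P - I may be large a priori, because an almost optimal P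
  comes with no bound on its size. Positivity of P^T P is what makes the test against K coercive for
  every K.\<close>

lemma gram_near_identity:
  assumes small: "sqrt (err X Y) \<le> \<alpha> / 10" and X_e: "X * e = X" and Y_e: "Y * e = Y"
    and gl: "gl P Q" and \<tau>: "0 < \<tau>" "\<tau> \<le> 1"
    and err: "\<beta> * sqrt (err X Y) \<le> \<tau> * \<alpha>\<^sup>2 / 20"
    and imb: "norm (imbalance (X * Q) (Y * tp P)) \<le> \<tau> * \<alpha>\<^sup>2 / 3"
  shows "norm (tp P * P - e) \<le> \<tau>"
proof -
  define K where "K = tp P * P - e"
  define D where "D = imbalance (X * Q) (Y * tp P)"
  define k m n where "k = norm K" and "m = norm (K * tp P)" and "n = norm D"
  have PQ: "e * P = P" "P * e = P" "Q * P = e" "P * Q = e" using gl by (auto simp: gl_def)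
  have tpP: "tp P * e = tp P" "e * tp P = tp P" using PQ tp_e by (metis tp_mult)+
  have PP: "tp P * P = e + K" by (simp add: K_def)
  have tpK: "tp K = K" by (simp add: K_def tp_e)
  have eK: "e * K = K" "K * e = K"
    using PQ tpP by (simp_all add: K_def right_diff_distrib left_diff_distrib e_e mult.assoc flip: mult.assoc[of e])
  have XQP: "X * Q * P = X" using PQ X_e by (simp add: mult.assoc)
  have YPP: "Y * tp P * P = Y + Y * K" using PP Y_e by (simp add: mult.assoc distrib_left)
  have "tp P * D * P = tp (X * Q * P) * (X * Q * P) - tp (Y * tp P * P) * (Y * tp P * P)"
    unfolding D_def imbalance_def by (simp add: left_diff_distrib right_diff_distrib mult.assoc)
  then have id: "imbalance X Y - tp P * D * P = tp Y * (Y * K) + tp (Y * K) * Y + tp (Y * K) * (Y * K)"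
    unfolding XQP YPP by (simp add: imbalance_def algebra_simps tpK)
  have j1: "inner (tp Y * (Y * K)) K = (norm (Y * K))\<^sup>2"
    by (simp add: inner_times_left power2_norm_eq_inner)
  have j2: "inner (tp (Y * K) * Y) K = (norm (Y * K))\<^sup>2"
  proof -
    have "inner (tp (Y * K) * Y) K = inner Y (Y * K * K)"
      by (simp only: inner_times_left[of "tp (Y * K)"] tp_tp)
    also have "\<dots> = inner (Y * K * K) Y"
      by (rule inner_commute)
    also have "\<dots> = inner (Y * K) (Y * K)"
      by (subst inner_times_right) (simp add: tpK)
    finally show ?thesis by (simp add: power2_norm_eq_inner)
  qed
  \<comment> \<open>The cubic term has no sign for a general symmetric K. Substituting K = P^T P - I
    shows that it is at least -|Y K|^2, which the two linear terms j1 and j2 compensate.\<close>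
  have j3: "inner (tp (Y * K) * (Y * K)) K = (norm (Y * (K * tp P)))\<^sup>2 - (norm (Y * K))\<^sup>2"
  proof -
    have YKK: "Y * K * K = Y * K * tp P * P - Y * K"
    proof -
      have "Y * K * tp P * P = Y * K * (e + K)" by (simp add: mult.assoc flip: PP)
      also have "\<dots> = Y * K + Y * K * K" using eK by (simp add: distrib_left mult.assoc)
      finally show ?thesis by simp
    qed
    have "inner (tp (Y * K) * (Y * K)) K = inner (Y * K) (Y * K * K)"
      by (simp only: inner_times_left[of "tp (Y * K)"] tp_tp)
    also have "\<dots> = inner (Y * K) (Y * K * tp P * P) - (norm (Y * K))\<^sup>2"
      unfolding YKK by (simp add: inner_diff power2_norm_eq_inner)
    also have "inner (Y * K) (Y * K * tp P * P) = inner (Y * K * tp P) (Y * K * tp P)"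
      by (subst inner_commute) (simp add: inner_times_right[of "Y * K * tp P" P])
    finally show ?thesis by (simp add: power2_norm_eq_inner mult.assoc)
  qed
  have "inner (imbalance X Y - tp P * D * P) K = (norm (Y * K))\<^sup>2 + (norm (Y * (K * tp P)))\<^sup>2"
    unfolding id by (simp only: inner_add_left j1 j2 j3)
  moreover have "(9 / 10 * \<alpha> * k)\<^sup>2 \<le> (norm (Y * K))\<^sup>2"
    using lower_Y[OF small Y_e, of K] \<alpha>_pos unfolding eK by (intro power_mono) (auto simp: k_def)
  moreover have "(9 / 10 * \<alpha> * m)\<^sup>2 \<le> (norm (Y * (K * tp P)))\<^sup>2"
    using lower_Y[OF small Y_e, of "K * tp P"] \<alpha>_pos eK
    by (intro power_mono) (auto simp: m_def simp flip: mult.assoc)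
  moreover have "inner (imbalance X Y) K \<le> 21 / 5 * (\<beta> * sqrt (err X Y)) * k"
  proof -
    have "inner (imbalance X Y) K \<le> norm (imbalance X Y) * k"
      unfolding k_def by (rule norm_cauchy_schwarz)
    also have "\<dots> \<le> 21 / 5 * \<beta> * sqrt (err X Y) * k"
      by (intro mult_right_mono imbalance_upper small) (simp add: k_def)
    finally show ?thesis by simp
  qed
  moreover have "- inner (tp P * D * P) K \<le> n * (sqrt (1 + k) * m)"
  proof -
    \<comment> \<open>The operator norm of P is bounded by sqrt (1 + k), that is, by the quantity k
      under estimation itself.\<close>
    have "norm (P * (K * tp P)) \<le> sqrt (1 + k) * m"
    proof -
      define M where "M = K * tp P"
      have eM: "e * M = M" using eK by (simp add: M_def flip: mult.assoc)
      have "(norm (P * M))\<^sup>2 = inner M (tp P * P * M)"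
        by (simp add: power2_norm_eq_inner inner_times_left mult.assoc)
      also have "\<dots> = (norm M)\<^sup>2 + inner M (K * M)"
        unfolding PP by (simp add: distrib_right eM inner_add power2_norm_eq_inner)
      also have "inner M (K * M) \<le> norm M * (k * norm M)"
        unfolding k_def
        by (intro order_trans[OF norm_cauchy_schwarz] mult_left_mono norm_mult_ineq) simp
      finally have "(norm (P * M))\<^sup>2 \<le> (1 + k) * (norm M)\<^sup>2" by (simp add: power2_eq_square algebra_simps)
      also have "\<dots> = (sqrt (1 + k) * norm M)\<^sup>2" by (simp add: power_mult_distrib k_def)
      finally show ?thesis
        unfolding m_def M_def by (rule power2_le_imp_le) (simp add: k_def)
    qed
    moreover have "inner (tp P * D * P) K = inner D (P * (K * tp P))"
      using inner_times_left[of "tp P" "D * P" K] inner_times_right[of D P "P * K"]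
      by (simp add: mult.assoc)
    moreover have "- inner D (P * (K * tp P)) \<le> n * norm (P * (K * tp P))"
      unfolding n_def by (metis Cauchy_Schwarz_ineq2 abs_le_D2)
    ultimately show ?thesis
      using mult_left_mono[of "norm (P * (K * tp P))" "sqrt (1 + k) * m" n] by (simp add: n_def)
  qed
  ultimately have main: "(9 / 10 * \<alpha> * k)\<^sup>2 + (9 / 10 * \<alpha> * m)\<^sup>2
      \<le> 21 / 5 * (\<beta> * sqrt (err X Y)) * k + n * (sqrt (1 + k) * m)"
    by (simp add: inner_diff)
  have k0: "0 \<le> k" by (simp add: k_def)
  have A: "21 / 5 * (\<beta> * sqrt (err X Y)) * k \<le> 21 / 100 * (\<alpha>\<^sup>2 * (\<tau> * k))"
    using mult_right_mono[OF err k0] by (simp add: ac_simps)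
  have "n * (sqrt (1 + k) * m) \<le> \<tau> * \<alpha>\<^sup>2 / 3 * (sqrt (1 + k) * m)"
    using imb k0 by (intro mult_right_mono) (auto simp: n_def D_def m_def)
  also have "\<dots> = (\<alpha> * m) * (\<tau> * \<alpha> * sqrt (1 + k) / 3)" by (simp add: power2_eq_square)
  \<comment> \<open>The weights are chosen so that the square containing m equals the one on the
    left of \<open>main\<close>. It cancels, and an inequality in k alone remains.\<close>
  also have "\<dots> \<le> (9 / 10 * \<alpha> * m)\<^sup>2 + (\<tau> * \<alpha> * sqrt (1 + k) / 3)\<^sup>2 / 3"
  proof -
    have "\<alpha> * m * y \<le> (9 / 10 * \<alpha> * m)\<^sup>2 + y\<^sup>2 / 3" for y
    proof -
      have "\<alpha> * m * y \<le> (9 / 10 * \<alpha> * m)\<^sup>2 + 25 / 81 * y\<^sup>2"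
        using sum_squares_bound[of "9 / 10 * \<alpha> * m" "5 / 9 * y"]
        by (simp add: power_mult_distrib power_divide)
      then show ?thesis using zero_le_power2[of y] by linarith
    qed
    then show ?thesis .
  qed
  also have "(\<tau> * \<alpha> * sqrt (1 + k) / 3)\<^sup>2 = \<alpha>\<^sup>2 * (\<tau>\<^sup>2 * (1 + k)) / 9"
    using k0 by (simp add: power_mult_distrib power_divide)
  finally have "n * (sqrt (1 + k) * m) \<le> (9 / 10 * \<alpha> * m)\<^sup>2 + \<alpha>\<^sup>2 * (\<tau>\<^sup>2 * (1 + k)) / 9 / 3" .
  moreover have "(9 / 10 * \<alpha> * k)\<^sup>2 = \<alpha>\<^sup>2 * (81 / 100 * k\<^sup>2)"
    by (simp add: power_mult_distrib power_divide)
  moreover have "\<alpha>\<^sup>2 * (21 / 100 * (\<tau> * k) + \<tau>\<^sup>2 * (1 + k) / 27)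
      = 21 / 100 * (\<alpha>\<^sup>2 * (\<tau> * k)) + \<alpha>\<^sup>2 * (\<tau>\<^sup>2 * (1 + k)) / 9 / 3"
    by (simp add: algebra_simps)
  ultimately have "\<alpha>\<^sup>2 * (81 / 100 * k\<^sup>2) \<le> \<alpha>\<^sup>2 * (21 / 100 * (\<tau> * k) + \<tau>\<^sup>2 * (1 + k) / 27)"
    using main A by linarith
  then have k2: "81 / 100 * k\<^sup>2 \<le> 21 / 100 * (\<tau> * k) + \<tau>\<^sup>2 * (1 + k) / 27"
    using \<alpha>_pos by simp
  have "k \<le> \<tau>"
  \<comment> \<open>If k exceeds \<tau>, every term on the right of \<open>k2\<close> is at most a
    multiple of k^2, with total 21/100 + 2/27 < 81/100.\<close>
  proof (rule ccontr)
    assume "\<not> k \<le> \<tau>"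
    then have k: "\<tau> < k" "0 < k" using \<tau> by auto
    have "\<tau> * k \<le> k\<^sup>2" using k by (simp add: power2_eq_square)
    moreover have "\<tau>\<^sup>2 \<le> k\<^sup>2" using k \<tau> by (intro power_mono) auto
    moreover have "\<tau>\<^sup>2 * k \<le> \<tau> * k"
      using \<tau> k by (intro mult_right_mono) (auto simp: power2_eq_square mult_left_le)
    moreover have "81 / 100 * k\<^sup>2 \<le> 21 / 100 * (\<tau> * k) + \<tau>\<^sup>2 / 27 + \<tau>\<^sup>2 * k / 27"
      using k2 by (simp add: distrib_left add_divide_distrib)
    moreover have "0 < k\<^sup>2" using k by simp
    ultimately show False by linarith
  qed
  then show ?thesis by (simp add: k_def K_def)
qed


lemma gl_gram_inverse:
  assumes "gl P Q"
  shows "Q * tp Q * (tp P * P) = e"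
proof -
  have "P * Q = e" "Q * P = e" "e * P = P" "e * Q = Q" using assms by (auto simp: gl_def)
  moreover have "tp P * e = tp P" "tp Q * e = tp Q"
    using assms tp_e unfolding gl_def by (metis tp_mult)+
  moreover have "tp P * tp Q = e" "tp Q * tp P = e"
    using calculation tp_e by (metis tp_mult)+
  ultimately show ?thesis
    by (metis mult.assoc)
qed

section \<open>One gradient step in aligned coordinates\<close>

context
  fixes X Y P Q :: fmat
  assumes small: "sqrt (err X Y) \<le> \<alpha> / 10" and X_e: "X * e = X" and Y_e: "Y * e = Y"
    and gl: "gl P Q" and gram: "norm (tp P * P - e) \<le> \<alpha> / (100 * \<beta>)"
begin

lemma norm_gram: "norm (tp P * P - e) \<le> 1 / 100"
proof (rule order_trans[OF gram])
  show "\<alpha> / (100 * \<beta>) \<le> 1 / 100"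
    using \<beta>_pos \<alpha>_le_\<beta> by (simp add: divide_simps)
qed

lemma residual_Y: "norm (residual X Y * Y) \<le> 11 / 10 * \<beta> * norm (residual X Y)"
  and residual_X: "norm (tp (residual X Y) * X) \<le> 11 / 10 * \<beta> * norm (residual X Y)"
  using op_bound_right[OF op_bound_X(2)[OF small], of "residual X Y"]
    op_bound_right[OF op_bound_X(1)[OF small], of "tp (residual X Y)"] by simp_all

text \<open>No bound on the inverse Gram matrix Q Q^T is used. The product B with it satisfies
  (residual)^T X = B + B K with |K| \<le> 1/100, so B is recovered from the left side up to a factor
  100/99.\<close>

lemma residual_X_inverse:
  "norm (tp (residual X Y) * X * (Q * tp Q)) \<le> 6 / 5 * \<beta> * norm (residual X Y)"
  "norm (tp (residual X Y) * X * (Q * tp Q) - tp (residual X Y) * X)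
    \<le> norm (tp P * P - e) * (6 / 5 * \<beta> * norm (residual X Y))"
proof -
  define B K where "B = tp (residual X Y) * X * (Q * tp Q)" and "K = tp P * P - e"
  have "B * e = tp (residual X Y) * X * (Q * (tp Q * e))" by (simp add: B_def mult.assoc)
  also have "tp Q * e = tp Q" using gl tp_e unfolding gl_def by (metis tp_mult)
  finally have Be: "B * e = B" by (simp add: B_def mult.assoc)
  have "B * (tp P * P) = tp (residual X Y) * X * (Q * tp Q * (tp P * P))"
    by (simp add: B_def mult.assoc)
  then have "B * (tp P * P) = tp (residual X Y) * X"
    using gl_gram_inverse[OF gl] X_e by (simp add: mult.assoc)
  then have BK: "tp (residual X Y) * X = B + B * K"
    by (simp add: K_def right_diff_distrib Be)
  have nBK: "norm (B * K) \<le> norm K * norm B"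
    using norm_mult_ineq[of B K] by (simp add: mult.commute)
  have "norm B \<le> norm (tp (residual X Y) * X) + norm (B * K)"
    unfolding BK by (metis add_diff_cancel_right' norm_triangle_ineq4)
  also have "norm (B * K) \<le> 1 / 100 * norm B"
    using nBK mult_right_mono[OF norm_gram norm_ge_zero[of B]] unfolding K_def by linarith
  finally have "99 / 100 * norm B \<le> 11 / 10 * \<beta> * norm (residual X Y)"
    using residual_X by simp
  moreover have "0 \<le> \<beta> * norm (residual X Y)" using \<beta>_pos by simp
  ultimately have nB: "norm B \<le> 6 / 5 * \<beta> * norm (residual X Y)" by simp
  then show "norm (tp (residual X Y) * X * (Q * tp Q)) \<le> 6 / 5 * \<beta> * norm (residual X Y)"
    by (simp add: B_def)
  have "norm (B * K) \<le> norm K * (6 / 5 * \<beta> * norm (residual X Y))"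
    using nBK mult_left_mono[OF nB norm_ge_zero[of K]] by linarith
  moreover have "B - tp (residual X Y) * X = - (B * K)" unfolding BK by simp
  ultimately show "norm (tp (residual X Y) * X * (Q * tp Q) - tp (residual X Y) * X)
      \<le> norm (tp P * P - e) * (6 / 5 * \<beta> * norm (residual X Y))"
    by (simp add: B_def K_def)
qed

lemma residual_Y_gram:
  "norm (residual X Y * Y * (tp P * P)) \<le> 6 / 5 * \<beta> * norm (residual X Y)"
  "norm (residual X Y * Y * (tp P * P) - residual X Y * Y)
    \<le> norm (tp P * P - e) * (6 / 5 * \<beta> * norm (residual X Y))"
proof -
  define K where "K = tp P * P - e"
  have eq: "residual X Y * Y * (tp P * P) - residual X Y * Y = residual X Y * Y * K"
    using Y_e by (simp add: K_def right_diff_distrib mult.assoc)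
  have 0: "0 \<le> \<beta> * norm (residual X Y)" using \<beta>_pos by simp
  have nK: "norm (residual X Y * Y * K) \<le> norm K * (11 / 10 * \<beta> * norm (residual X Y))"
    using norm_mult_ineq[of "residual X Y * Y" K] mult_left_mono[OF residual_Y norm_ge_zero[of K]]
    by (simp add: ac_simps)
  also have "\<dots> \<le> norm K * (6 / 5 * \<beta> * norm (residual X Y))"
    using 0 by (intro mult_left_mono) auto
  finally show "norm (residual X Y * Y * (tp P * P) - residual X Y * Y)
      \<le> norm (tp P * P - e) * (6 / 5 * \<beta> * norm (residual X Y))"
    unfolding eq by (simp add: K_def)
  have "norm (residual X Y * Y * (tp P * P)) \<le> norm (residual X Y * Y) + norm (residual X Y * Y * K)"
    unfolding eq[symmetric] by (metis add.commute diff_add_cancel norm_triangle_ineq)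
  also have "norm (residual X Y * Y * K) \<le> 1 / 100 * (11 / 10 * \<beta> * norm (residual X Y))"
  proof (rule order_trans[OF nK mult_right_mono])
    show "norm K \<le> 1 / 100" using norm_gram by (simp add: K_def)
  qed (use 0 in simp)
  finally show "norm (residual X Y * Y * (tp P * P)) \<le> 6 / 5 * \<beta> * norm (residual X Y)"
    using residual_Y 0 by simp
qed

text \<open>The descent direction is compared with the unmodified gradient, whose inner product with
  the error is m^2 up to a cubic term. Only afterwards is m^2 traded for \<open>err\<close> by the
  lower bound on the residual, so a part of m^2 stays available to absorb the second order term of
  the step.\<close>

lemma aligned_step:
  assumes h: "0 < h" "h * \<beta>\<^sup>2 \<le> 1 / 32"
  shows "err (X - h *\<^sub>R (residual X Y * Y * (tp P * P))) (Y - h *\<^sub>R (tp (residual X Y) * X * (Q * tp Q)))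
    \<le> err X Y - h * \<alpha>\<^sup>2 / 2 * err X Y + 2 * h * (norm (gauge X Y))\<^sup>2"
proof -
  define dx dy E where "dx = X - Xs" and "dy = Y - Ys" and "E = residual X Y"
  define m k \<delta> where "m = norm E" and "k = norm (tp P * P - e)" and "\<delta> = sqrt (err X Y)"
  define A B where "A = E * Y * (tp P * P)" and "B = tp E * X * (Q * tp Q)"
  have \<delta>: "\<delta>\<^sup>2 = err X Y" "0 \<le> \<delta>" using err_nonneg by (simp_all add: \<delta>_def)
  have m0: "0 \<le> m" by (simp add: m_def)
  have "err (X - h *\<^sub>R A) (Y - h *\<^sub>R B)
      = (norm (dx - h *\<^sub>R A))\<^sup>2 + (norm (dy - h *\<^sub>R B))\<^sup>2"
    by (simp add: err_def dx_def dy_def algebra_simps)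
  also have "\<dots> = \<delta>\<^sup>2 - 2 * h * (inner A dx + inner B dy) + h\<^sup>2 * ((norm A)\<^sup>2 + (norm B)\<^sup>2)"
  proof -
    have "(norm (d - h *\<^sub>R C))\<^sup>2 = (norm d)\<^sup>2 - 2 * h * inner C d + h\<^sup>2 * (norm C)\<^sup>2" for d C :: fmat
      unfolding power2_norm_eq_inner by (simp add: inner_diff inner_commute power2_eq_square)
    then show ?thesis
      unfolding \<delta>(1) err_def dx_def[symmetric] dy_def[symmetric] by (simp add: algebra_simps)
  qed
  finally have expand: "err (X - h *\<^sub>R A) (Y - h *\<^sub>R B)
      = \<delta>\<^sup>2 - 2 * h * (inner A dx + inner B dy) + h\<^sup>2 * ((norm A)\<^sup>2 + (norm B)\<^sup>2)" .
  have drop: "inner A' d - \<beta> * k * (6 / 5 * (m * \<delta>)) \<le> inner A d"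
    if "norm (A - A') \<le> k * (6 / 5 * \<beta> * m)" "norm d \<le> \<delta>" for A A' d :: fmat
  proof -
    have "- inner (A - A') d \<le> norm (A - A') * norm d"
      by (metis Cauchy_Schwarz_ineq2 abs_le_D2)
    also have "\<dots> \<le> k * (6 / 5 * \<beta> * m) * \<delta>"
      using that \<beta>_pos m0 by (intro mult_mono) (auto simp: k_def)
    finally show ?thesis by (simp add: inner_diff ac_simps)
  qed
  have A1: "inner (E * Y) dx - \<beta> * k * (6 / 5 * (m * \<delta>)) \<le> inner A dx"
    using residual_Y_gram(2) norm_le_sqrt_err(1)
    by (intro drop) (auto simp: A_def E_def k_def m_def dx_def \<delta>_def)
  have B1: "inner (tp E * X) dy - \<beta> * k * (6 / 5 * (m * \<delta>)) \<le> inner B dy"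
    using residual_X_inverse(2) norm_le_sqrt_err(2)
    by (intro drop) (auto simp: B_def E_def k_def m_def dy_def \<delta>_def)
  \<comment> \<open>This product dictates the tolerance \<alpha> / (100 \<beta>) for the Gram
    matrix: the loss becomes a small multiple of \<alpha> m \<delta>, which m^2 and \<alpha>^2
    \<delta>^2 can absorb.\<close>
  have "\<beta> * k \<le> \<alpha> / 100"
    using mult_left_mono[OF gram, of \<beta>] \<beta>_pos by (simp add: k_def)
  then have small_k: "\<beta> * k * (6 / 5 * (m * \<delta>)) \<le> \<alpha> / 100 * (6 / 5 * (m * \<delta>))"
    using m0 \<delta>(2) by (intro mult_right_mono) auto
  have "inner (tp E * X) dy = inner X (E * dy)"
    by (simp add: inner_times_left)
  also have "\<dots> = inner E (X * tp dy)"
    by (metis inner_commute inner_times_right)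
  finally have "inner (E * Y) dx + inner (tp E * X) dy = inner E (dx * tp Y + X * tp dy)"
    by (simp add: inner_times_right inner_add)
  \<comment> \<open>The residual is bilinear in the two factors; linearizing it at (X, Y) rather
    than at the ground truth leaves the single product dx dy^T as remainder.\<close>
  also have "dx * tp Y + X * tp dy = E + dx * tp dy"
    by (simp add: dx_def dy_def E_def residual_def algebra_simps)
  also have "inner E (E + dx * tp dy) \<ge> m\<^sup>2 - m * (\<delta>\<^sup>2 / 2)"
  proof -
    have "- inner E (dx * tp dy) \<le> m * norm (dx * tp dy)"
      unfolding m_def by (metis Cauchy_Schwarz_ineq2 abs_le_D2)
    also have "\<dots> \<le> m * (\<delta>\<^sup>2 / 2)"
    proof (intro mult_left_mono m0)
      show "norm (dx * tp dy) \<le> \<delta>\<^sup>2 / 2"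
        using norm_mult_ineq[of dx "tp dy"] mult_norms_le_err[of X Y]
        unfolding norm_tp dx_def[symmetric] dy_def[symmetric] \<delta>(1) by linarith
    qed
    finally show ?thesis by (simp add: inner_add m_def power2_norm_eq_inner)
  qed
  finally have "m\<^sup>2 - m * (\<delta>\<^sup>2 / 2) - \<alpha> / 100 * (12 / 5 * (m * \<delta>)) \<le> inner A dx + inner B dy"
    using A1 B1 small_k by linarith
  moreover have "m * (\<delta>\<^sup>2 / 2) \<le> \<alpha> / 20 * (m * \<delta>)"
    using mult_right_mono[OF small, of "m * \<delta>"] m0 \<delta>(2) by (simp add: \<delta>_def power2_eq_square ac_simps)
  moreover have "\<alpha> / 10 * (m * \<delta>) \<le> m\<^sup>2 / 4 + \<alpha>\<^sup>2 * \<delta>\<^sup>2 / 100"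
    using sum_squares_bound[of "m / 2" "\<alpha> * \<delta> / 10"]
    by (simp add: power_mult_distrib power_divide ac_simps)
  moreover have "0 \<le> \<alpha> * (m * \<delta>)" using \<alpha>_pos m0 \<delta>(2) by simp
  ultimately have first: "3 / 4 * m\<^sup>2 - \<alpha>\<^sup>2 * \<delta>\<^sup>2 / 100 \<le> inner A dx + inner B dy" by linarith
  have nA: "(norm A)\<^sup>2 \<le> (6 / 5 * \<beta> * m)\<^sup>2" and nB: "(norm B)\<^sup>2 \<le> (6 / 5 * \<beta> * m)\<^sup>2"
    using residual_Y_gram(1) residual_X_inverse(1)
    by (auto simp: A_def B_def E_def m_def intro!: power_mono)
  have "(norm A)\<^sup>2 + (norm B)\<^sup>2 \<le> 8 * (\<beta>\<^sup>2 * m\<^sup>2)"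
  proof -
    have "(6 / 5 * \<beta> * m)\<^sup>2 = 36 / 25 * (\<beta>\<^sup>2 * m\<^sup>2)"
      by (simp add: power_mult_distrib power_divide)
    then show ?thesis
      using nA nB mult_nonneg_nonneg[OF zero_le_power2[of \<beta>] zero_le_power2[of m]]
      by linarith
  qed
  from mult_left_mono[OF this, of "h\<^sup>2"] have "h\<^sup>2 * ((norm A)\<^sup>2 + (norm B)\<^sup>2) \<le> h\<^sup>2 * (8 * (\<beta>\<^sup>2 * m\<^sup>2))"
    by simp
  also have "\<dots> = h * \<beta>\<^sup>2 * (8 * h * m\<^sup>2)" by (simp add: power2_eq_square)
  also have "\<dots> \<le> 1 / 32 * (8 * h * m\<^sup>2)"
    using h by (intro mult_right_mono) auto
  finally have second: "h\<^sup>2 * ((norm A)\<^sup>2 + (norm B)\<^sup>2) \<le> h * m\<^sup>2 / 4" by simp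
  have third: "h * (12 / 25 * \<alpha>\<^sup>2 * \<delta>\<^sup>2 - (norm (gauge X Y))\<^sup>2) \<le> h * m\<^sup>2"
    using residual_lower[OF small X_e Y_e] h by (intro mult_left_mono) (auto simp: \<delta>(1) m_def E_def)
  have "h * (3 / 4 * m\<^sup>2 - \<alpha>\<^sup>2 * \<delta>\<^sup>2 / 100) \<le> h * (inner A dx + inner B dy)"
    using first h by (intro mult_left_mono) auto
  then have "err (X - h *\<^sub>R A) (Y - h *\<^sub>R B)
      \<le> \<delta>\<^sup>2 - 2 * (h * (3 / 4 * m\<^sup>2 - \<alpha>\<^sup>2 * \<delta>\<^sup>2 / 100)) + h * m\<^sup>2 / 4"
    using expand second by simp
  \<comment> \<open>In total -5/4 h m^2 is left. The residual bound turns it into -3/5 h \<alpha>^2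
    \<delta>^2 plus 5/4 h times the squared gauge defect; the margin over 1/2 pays for the remaining
    1/50.\<close>
  also have "\<dots> \<le> \<delta>\<^sup>2 - h * \<alpha>\<^sup>2 / 2 * \<delta>\<^sup>2 + 2 * h * (norm (gauge X Y))\<^sup>2"
  proof -
    have "0 \<le> h * (\<alpha>\<^sup>2 * \<delta>\<^sup>2)" "0 \<le> h * (norm (gauge X Y))\<^sup>2" using h by auto
    then show ?thesis using third by (simp add: algebra_simps)
  qed
  finally show ?thesis unfolding A_def B_def E_def \<delta>(1) .
qed

text \<open>Both gradients contribute the same first order term Xt^T E Yt + Yt^T E^T Xt to the two
  Gram matrices, so it cancels in their difference. The squared step remains, and the residual in it
  is of the order of the error.\<close>

lemma imbalance_step:
  assumes h: "0 < h" "h * \<beta>\<^sup>2 \<le> 1 / 32"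
  defines "Xt \<equiv> X * Q" and "Yt \<equiv> Y * tp P"
  shows "norm (imbalance (Xt - h *\<^sub>R (residual X Y * Yt)) (Yt - h *\<^sub>R (tp (residual X Y) * Xt)))
    \<le> norm (imbalance Xt Yt) + err X Y / 64"
proof -
  define E m where "E = residual X Y" and "m = norm E"
  have E: "E = Xt * tp Yt - Xs * tp Ys"
    using gl X_e by (simp add: E_def residual_def Xt_def Yt_def gl_def mult.assoc) (metis mult.assoc)
  define R where "R = tp (E * Yt) * (E * Yt) - tp (tp E * Xt) * (tp E * Xt)"
  have "imbalance (Xt - h *\<^sub>R (E * Yt)) (Yt - h *\<^sub>R (tp E * Xt)) = imbalance Xt Yt + h\<^sup>2 *\<^sub>R R"
    unfolding imbalance_def R_def by (simp add: algebra_simps power2_eq_square)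
  then have step: "norm (imbalance (Xt - h *\<^sub>R (E * Yt)) (Yt - h *\<^sub>R (tp E * Xt)))
      \<le> norm (imbalance Xt Yt) + h\<^sup>2 * norm R"
    using norm_triangle_ineq[of "imbalance Xt Yt" "h\<^sup>2 *\<^sub>R R"] by simp
  have "norm R \<le> (norm (E * Yt))\<^sup>2 + (norm (tp E * Xt))\<^sup>2"
    unfolding R_def
    using norm_triangle_ineq4[of "tp (E * Yt) * (E * Yt)" "tp (tp E * Xt) * (tp E * Xt)"]
      norm_mult_ineq[of "tp (E * Yt)" "E * Yt"] norm_mult_ineq[of "tp (tp E * Xt)" "tp E * Xt"]
    unfolding norm_tp power2_eq_square by linarith
  moreover have "(norm (E * Yt))\<^sup>2 \<le> (11 / 10 * \<beta> * m) * (6 / 5 * \<beta> * m)"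
  proof -
    \<comment> \<open>The gradients are those of the iterates, but all bounds are for the aligned
      factors. Moving P^T to the other side of the inner product makes only P^T P appear.\<close>
    have "(norm (E * Yt))\<^sup>2 = inner (E * Y) (E * Y * (tp P * P))"
      using norm_mult_squared[of "E * Y" "tp P"] by (simp add: Yt_def mult.assoc)
    also have "\<dots> \<le> (11 / 10 * \<beta> * m) * (6 / 5 * \<beta> * m)"
      using residual_Y residual_Y_gram(1) \<beta>_pos
      by (intro order_trans[OF norm_cauchy_schwarz] mult_mono) (auto simp: E_def m_def)
    finally show ?thesis .
  qed
  moreover have "(norm (tp E * Xt))\<^sup>2 \<le> (11 / 10 * \<beta> * m) * (6 / 5 * \<beta> * m)"
  proof -
    have "(norm (tp E * Xt))\<^sup>2 = inner (tp E * X) (tp E * X * (Q * tp Q))"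
      using norm_mult_squared[of "tp E * X" Q] by (simp add: Xt_def mult.assoc)
    also have "\<dots> \<le> (11 / 10 * \<beta> * m) * (6 / 5 * \<beta> * m)"
      using residual_X residual_X_inverse(1) \<beta>_pos
      by (intro order_trans[OF norm_cauchy_schwarz] mult_mono) (auto simp: E_def m_def)
    finally show ?thesis .
  qed
  ultimately have "norm R \<le> 66 / 25 * (\<beta>\<^sup>2 * m\<^sup>2)"
    by (simp add: power2_eq_square ac_simps)
  then have "h\<^sup>2 * norm R \<le> h\<^sup>2 * (66 / 25 * (\<beta>\<^sup>2 * m\<^sup>2))"
    by (intro mult_left_mono) auto
  also have "h\<^sup>2 * (66 / 25 * (\<beta>\<^sup>2 * m\<^sup>2)) \<le> h\<^sup>2 * (66 / 25 * (\<beta>\<^sup>2 * (5 * \<beta>\<^sup>2 * err X Y)))"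
    using residual_upper[OF small] by (intro mult_left_mono) (auto simp: m_def E_def)
  also have "\<dots> = (h * \<beta>\<^sup>2)\<^sup>2 * (66 / 5 * err X Y)" by (simp add: power2_eq_square)
  also have "\<dots> \<le> (1 / 32)\<^sup>2 * (66 / 5 * err X Y)"
    using h err_nonneg by (intro mult_right_mono power_mono) auto
  \<comment> \<open>The factor 66 / (5 * 32^2) is just below 1/64. The value 1/64 is matched to the
    contraction rate of the squared distance, which is \<alpha>^2 / (64 \<beta>^2).\<close>
  also have "\<dots> \<le> err X Y / 64" using err_nonneg[of X Y] by (simp add: power2_eq_square)
  finally show ?thesis using step unfolding E_def by simp
qed

end


section \<open>Passage to the infimum over alignments and iteration\<close>

lemma gl_e: "gl e e"
  by (simp add: gl_def e_e)

lemma gl_comp: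
  assumes "gl P Q" "gl P' Q'"
  shows "gl (P * P') (Q' * Q)"
  using assms unfolding gl_def by (metis mult.assoc)

definition fdist :: "fmat \<Rightarrow> fmat \<Rightarrow> real" where
  "fdist X Y = Inf {sqrt (err (X * P) (Y * tp Q)) | P Q. gl P Q}"

lemma fdist_le:
  assumes "gl P Q"
  shows "fdist X Y \<le> sqrt (err (X * P) (Y * tp Q))"
  unfolding fdist_def using assms
  by (intro cInf_lower bdd_belowI[of _ 0]) (auto simp: err_nonneg)

lemma fdist_nonneg: "0 \<le> fdist X Y"
  unfolding fdist_def using gl_e by (intro cInf_greatest) (auto simp: err_nonneg)

lemma fdist_sq_le:
  assumes "gl P Q"
  shows "(fdist X Y)\<^sup>2 \<le> err (X * P) (Y * tp Q)"
  using power_mono[OF fdist_le[OF assms] fdist_nonneg, of X Y 2] err_nonneg by simp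

lemma fdist_approx:
  assumes "0 < \<epsilon>"
  obtains P Q where "gl P Q" "err (X * P) (Y * tp Q) < (fdist X Y)\<^sup>2 + \<epsilon>"
proof -
  have "fdist X Y < sqrt ((fdist X Y)\<^sup>2 + \<epsilon>)"
    using assms by (intro real_less_rsqrt) simp
  then obtain P Q where "gl P Q" "sqrt (err (X * P) (Y * tp Q)) < sqrt ((fdist X Y)\<^sup>2 + \<epsilon>)"
    using gl_e unfolding fdist_def by (subst (asm) cInf_less_iff) (auto simp: err_nonneg intro!: bdd_belowI[of _ 0])
  with that show thesis by simp
qed

text \<open>The two thresholds are the hypotheses of \<open>gram_near_identity\<close> for the
  tolerance \<tau> = \<alpha> / (100 \<beta>): \<tau> \<alpha>^2 / 20, divided by \<beta>, for the
  distance and \<tau> \<alpha>^2 / 3 for the imbalance.\<close>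

lemma one_step:
  assumes inverse: "\<And>G. e * G = G \<Longrightarrow> G * e = G \<Longrightarrow> norm G \<le> 1 / 2 \<Longrightarrow> \<exists>H. gl (e + G) H"
    and X_e: "X * e = X" and Y_e: "Y * e = Y"
    and d: "fdist X Y < \<alpha> ^ 3 / (2000 * \<beta>\<^sup>2)"
    and imb: "norm (imbalance X Y) \<le> \<alpha> ^ 3 / (300 * \<beta>)"
  defines "h \<equiv> 1 / (32 * \<beta>\<^sup>2)"
  defines "X' \<equiv> X - h *\<^sub>R (residual X Y * Y)" and "Y' \<equiv> Y - h *\<^sub>R (tp (residual X Y) * X)"
  shows "(fdist X' Y')\<^sup>2 \<le> (1 - \<alpha>\<^sup>2 / (64 * \<beta>\<^sup>2)) * (fdist X Y)\<^sup>2"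
    and "norm (imbalance X' Y') \<le> norm (imbalance X Y) + (fdist X Y)\<^sup>2 / 64"
proof -
  define r where "r = \<alpha> ^ 3 / (2000 * \<beta>\<^sup>2)"
  have r2: "(fdist X Y)\<^sup>2 < r\<^sup>2"
    using d fdist_nonneg[of X Y] unfolding r_def by (intro power_strict_mono) auto
  have r_small: "r \<le> \<alpha> / 10"
  proof -
    have "\<alpha>\<^sup>2 \<le> \<beta>\<^sup>2" using \<alpha>_pos \<alpha>_le_\<beta> by (intro power_mono) auto
    then have "\<alpha> * \<alpha>\<^sup>2 \<le> \<alpha> * \<beta>\<^sup>2" using \<alpha>_pos by (intro mult_left_mono) auto
    moreover have "0 < \<alpha> * \<beta>\<^sup>2" using \<alpha>_pos \<beta>_pos by simp
    ultimately show ?thesis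
      using \<beta>_pos unfolding r_def by (simp add: field_simps power3_eq_cube power2_eq_square)
  qed
  have h: "0 < h" "h * \<beta>\<^sup>2 \<le> 1 / 32" "h * \<beta>\<^sup>2 = 1 / 32" using \<beta>_pos by (simp_all add: h_def)
  have both: "(fdist X' Y')\<^sup>2 \<le> (1 - \<alpha>\<^sup>2 / (64 * \<beta>\<^sup>2)) * (fdist X Y)\<^sup>2 + \<epsilon> \<and>
      norm (imbalance X' Y') \<le> norm (imbalance X Y) + (fdist X Y)\<^sup>2 / 64 + \<epsilon>"
    if "0 < \<epsilon>" for \<epsilon>
  proof -
    \<comment> \<open>The second entry of the minimum keeps the aligned error below r, so that the
      smallness conditions hold. The first leaves room for two losses of at most
      \<open>\<epsilon>'\<close> each: the gap to the infimum and the gauge term.\<close>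
    define \<epsilon>' where "\<epsilon>' = min (\<epsilon> / 2) (r\<^sup>2 - (fdist X Y)\<^sup>2)"
    have \<epsilon>': "0 < \<epsilon>'" "2 * \<epsilon>' \<le> \<epsilon>" "(fdist X Y)\<^sup>2 + \<epsilon>' \<le> r\<^sup>2"
      using r2 that by (auto simp: \<epsilon>'_def min_def)
    from fdist_approx[OF \<epsilon>'(1)] obtain P Q
      where gl: "gl P Q" and near: "err (X * P) (Y * tp Q) < (fdist X Y)\<^sup>2 + \<epsilon>'" by blast
    define A B where "A = X * P" and "B = Y * tp Q"
    have PQ: "P * e = P" "P * Q = e" "e * Q = Q" "tp Q * tp P = e"
      using gl tp_e unfolding gl_def by (metis tp_mult)+
    have A: "A * e = A" "A * Q = X" using PQ X_e by (simp_all add: A_def mult.assoc)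
    have B: "B * e = B" "B * tp P = Y"
      using PQ Y_e tp_e unfolding B_def by (metis mult.assoc tp_mult)+
    have "tp (Y * tp Q) = Q * tp Y" by simp
    then have res: "residual A B = residual X Y"
      using PQ X_e unfolding residual_def A_def B_def by (metis mult.assoc)
    have err: "err A B < (fdist X Y)\<^sup>2 + \<epsilon>'" using near by (simp add: A_def B_def)
    have sqrt_err: "sqrt (err A B) \<le> r"
      using err \<epsilon>'(3) \<alpha>_pos \<beta>_pos by (intro real_le_lsqrt) (auto simp: r_def)
    then have small: "sqrt (err A B) \<le> \<alpha> / 10" using r_small by linarith
    have gram: "norm (tp P * P - e) \<le> \<alpha> / (100 * \<beta>)"
    proof (rule gram_near_identity[OF small A(1) B(1) gl])
      show "0 < \<alpha> / (100 * \<beta>)" "\<alpha> / (100 * \<beta>) \<le> 1"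
        using \<alpha>_pos \<beta>_pos \<alpha>_le_\<beta> by (auto simp: divide_simps)
      have "\<beta> * sqrt (err A B) \<le> \<beta> * r" using sqrt_err \<beta>_pos by simp
      also have "\<dots> = \<alpha> / (100 * \<beta>) * \<alpha>\<^sup>2 / 20"
        using \<beta>_pos by (simp add: r_def field_simps power3_eq_cube power2_eq_square)
      finally show "\<beta> * sqrt (err A B) \<le> \<alpha> / (100 * \<beta>) * \<alpha>\<^sup>2 / 20" .
      show "norm (imbalance (A * Q) (B * tp P)) \<le> \<alpha> / (100 * \<beta>) * \<alpha>\<^sup>2 / 3"
        using imb unfolding A B by (simp add: power3_eq_cube power2_eq_square)
    qed
    from gauge_descent[OF small A(1) B(1) inverse] obtain P' Q' where gl': "gl P' Q'"
      and desc: "err (A * P') (B * tp Q') \<le> err A B - (norm (gauge A B))\<^sup>2 / (7 * \<beta>\<^sup>2)" by blast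
    have "(fdist X Y)\<^sup>2 \<le> err (A * P') (B * tp Q')"
      using fdist_sq_le[OF gl_comp[OF gl gl'], of X Y] by (simp add: A_def B_def mult.assoc)
    then have "(norm (gauge A B))\<^sup>2 / (7 * \<beta>\<^sup>2) \<le> \<epsilon>'" using desc err by linarith
    then have gauge: "(norm (gauge A B))\<^sup>2 \<le> 7 * \<beta>\<^sup>2 * \<epsilon>'"
      using \<beta>_pos by (simp add: pos_divide_le_eq ac_simps)
    have XP: "X' * P = A - h *\<^sub>R (residual A B * B * (tp P * P))"
    proof -
      have "B * (tp P * P) = Y * P" using B(2) by (simp flip: mult.assoc)
      then show ?thesis by (simp add: X'_def res left_diff_distrib mult.assoc flip: A_def)
    qed
    have YQ: "Y' * tp Q = B - h *\<^sub>R (tp (residual A B) * A * (Q * tp Q))"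
    proof -
      have "A * (Q * tp Q) = X * tp Q" using A(2) by (simp flip: mult.assoc)
      then show ?thesis by (simp add: Y'_def res left_diff_distrib mult.assoc flip: B_def)
    qed
    have "(fdist X' Y')\<^sup>2 \<le> err (X' * P) (Y' * tp Q)"
      by (rule fdist_sq_le[OF gl])
    also have "\<dots> \<le> err A B - h * \<alpha>\<^sup>2 / 2 * err A B + 2 * h * (norm (gauge A B))\<^sup>2"
      unfolding XP YQ by (rule aligned_step[OF small A(1) B(1) gl gram h(1,2)])
    also have "\<dots> \<le> (1 - \<alpha>\<^sup>2 / (64 * \<beta>\<^sup>2)) * ((fdist X Y)\<^sup>2 + \<epsilon>') + \<epsilon>'"
    proof -
      have "2 * h * (norm (gauge A B))\<^sup>2 \<le> 2 * h * (7 * \<beta>\<^sup>2 * \<epsilon>')"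
        using gauge h by (intro mult_left_mono) auto
      also have "\<dots> = 14 * (h * \<beta>\<^sup>2) * \<epsilon>'" by simp
      \<comment> \<open>The numerical factor is 14/32.\<close>
      also have "\<dots> \<le> \<epsilon>'" using \<epsilon>'(1) unfolding h(3) by simp
      finally have "2 * h * (norm (gauge A B))\<^sup>2 \<le> \<epsilon>'" .
      moreover have "err A B - h * \<alpha>\<^sup>2 / 2 * err A B = (1 - \<alpha>\<^sup>2 / (64 * \<beta>\<^sup>2)) * err A B"
        by (simp add: h_def algebra_simps)
      moreover have "(1 - \<alpha>\<^sup>2 / (64 * \<beta>\<^sup>2)) * err A B \<le> (1 - \<alpha>\<^sup>2 / (64 * \<beta>\<^sup>2)) * ((fdist X Y)\<^sup>2 + \<epsilon>')"
      proof (intro mult_left_mono)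
        have "\<alpha>\<^sup>2 \<le> \<beta>\<^sup>2" using \<alpha>_pos \<alpha>_le_\<beta> by (intro power_mono) auto
        moreover have "0 < \<beta>\<^sup>2" using \<beta>_pos by simp
        ultimately show "0 \<le> 1 - \<alpha>\<^sup>2 / (64 * \<beta>\<^sup>2)"
          using pos_divide_le_eq[of "64 * \<beta>\<^sup>2" "\<alpha>\<^sup>2" 1] by linarith
      qed (use err in simp)
      ultimately show ?thesis by linarith
    qed
    also have "\<dots> \<le> (1 - \<alpha>\<^sup>2 / (64 * \<beta>\<^sup>2)) * (fdist X Y)\<^sup>2 + \<epsilon>"
    proof -
      have "0 \<le> \<alpha>\<^sup>2 / (64 * \<beta>\<^sup>2) * \<epsilon>'" using \<epsilon>'(1) by simp
      moreover have "(1 - \<alpha>\<^sup>2 / (64 * \<beta>\<^sup>2)) * ((fdist X Y)\<^sup>2 + \<epsilon>')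
          = (1 - \<alpha>\<^sup>2 / (64 * \<beta>\<^sup>2)) * (fdist X Y)\<^sup>2 + \<epsilon>' - \<alpha>\<^sup>2 / (64 * \<beta>\<^sup>2) * \<epsilon>'"
        by (simp only: distrib_left left_diff_distrib)
      ultimately show ?thesis using \<epsilon>'(2) by linarith
    qed
    finally have 1: "(fdist X' Y')\<^sup>2 \<le> (1 - \<alpha>\<^sup>2 / (64 * \<beta>\<^sup>2)) * (fdist X Y)\<^sup>2 + \<epsilon>" .
    have "norm (imbalance X' Y') \<le> norm (imbalance X Y) + err A B / 64"
      using imbalance_step[OF small A(1) B(1) gl gram h(1,2)] unfolding A(2) B(2) res X'_def Y'_def .
    with 1 err \<epsilon>' show ?thesis by simp
  qed
  show "(fdist X' Y')\<^sup>2 \<le> (1 - \<alpha>\<^sup>2 / (64 * \<beta>\<^sup>2)) * (fdist X Y)\<^sup>2"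
    "norm (imbalance X' Y') \<le> norm (imbalance X Y) + (fdist X Y)\<^sup>2 / 64"
    using both by (auto intro: field_le_epsilon)
qed

lemma linear_convergence:
  fixes X Y :: "nat \<Rightarrow> fmat"
  assumes inverse: "\<And>G. e * G = G \<Longrightarrow> G * e = G \<Longrightarrow> norm G \<le> 1 / 2 \<Longrightarrow> \<exists>H. gl (e + G) H"
    and X_e: "X 0 * e = X 0" and Y_e: "Y 0 * e = Y 0"
    and d: "fdist (X 0) (Y 0) < \<alpha> ^ 3 / (2000 * \<beta>\<^sup>2)"
    and pot: "norm (imbalance (X 0) (Y 0)) + \<beta>\<^sup>2 / \<alpha>\<^sup>2 * (fdist (X 0) (Y 0))\<^sup>2 \<le> \<alpha> ^ 3 / (300 * \<beta>)"
    and X_Suc: "\<And>t. X (Suc t) = X t - (1 / (32 * \<beta>\<^sup>2)) *\<^sub>R (residual (X t) (Y t) * Y t)"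
    and Y_Suc: "\<And>t. Y (Suc t) = Y t - (1 / (32 * \<beta>\<^sup>2)) *\<^sub>R (tp (residual (X t) (Y t)) * X t)"
  shows "fdist (X t) (Y t) \<le> (1 - \<alpha>\<^sup>2 / (1600 * \<beta>\<^sup>2)) ^ t * fdist (X 0) (Y 0)"
proof -
  define \<rho> where "\<rho> = \<alpha>\<^sup>2 / \<beta>\<^sup>2"
  have \<rho>: "0 < \<rho>" "\<rho> \<le> 1"
    using \<alpha>_pos \<alpha>_le_\<beta> \<beta>_pos by (auto simp: \<rho>_def divide_simps power_mono)
  \<comment> \<open>The rate 1/1600 is \<eta> / 50 for \<eta> = 1/32. Its square stays above 1 -
    \<rho>/64, the contraction proved for the squared distance.\<close>
  define q where "q = 1 - \<rho> / 1600"
  have q: "0 \<le> q" "q \<le> 1" using \<rho> by (auto simp: q_def)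
  define d where "d t = fdist (X t) (Y t)" for t
  have d0: "0 \<le> d t" for t by (simp add: d_def fdist_nonneg)
  have "X t * e = X t \<and> Y t * e = Y t \<and> d t \<le> q ^ t * d 0 \<and>
      norm (imbalance (X t) (Y t)) + (d t)\<^sup>2 / \<rho> \<le> \<alpha> ^ 3 / (300 * \<beta>)"
  proof (induction t)
    case 0
    then show ?case using X_e Y_e pot by (simp add: d_def \<rho>_def mult.commute)
  next
    case (Suc t)
    have "q ^ t * d 0 \<le> d 0" using q d0 by (simp add: mult_left_le_one_le power_le_one)
    then have dt: "fdist (X t) (Y t) < \<alpha> ^ 3 / (2000 * \<beta>\<^sup>2)"
      using Suc assms(4) by (simp add: d_def)
    have "0 \<le> (d t)\<^sup>2 / \<rho>" using \<rho> by simp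
    then have imb: "norm (imbalance (X t) (Y t)) \<le> \<alpha> ^ 3 / (300 * \<beta>)" using Suc by linarith
    have XYe: "X t * e = X t" "Y t * e = Y t" using Suc by auto
    have A: "(d (Suc t))\<^sup>2 \<le> (1 - \<rho> / 64) * (d t)\<^sup>2"
      and B: "norm (imbalance (X (Suc t)) (Y (Suc t))) \<le> norm (imbalance (X t) (Y t)) + (d t)\<^sup>2 / 64"
      using one_step[OF inverse XYe dt imb] unfolding X_Suc Y_Suc d_def \<rho>_def
      by (simp_all add: mult.commute)
    have "1 - \<rho> / 64 \<le> q\<^sup>2"
      using \<rho> by (simp add: q_def power2_eq_square algebra_simps)
    then have "(d (Suc t))\<^sup>2 \<le> q\<^sup>2 * (d t)\<^sup>2"
      using A by (meson mult_right_mono order_trans zero_le_power2)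
    then have "(d (Suc t))\<^sup>2 \<le> (q * d t)\<^sup>2" by (simp add: power_mult_distrib)
    then have "d (Suc t) \<le> q * d t"
      by (rule power2_le_imp_le) (use q d0 in auto)
    also have "\<dots> \<le> q * (q ^ t * d 0)" using Suc q by (intro mult_left_mono) auto
    finally have "d (Suc t) \<le> q ^ Suc t * d 0" by simp
    \<comment> \<open>Dividing the contraction by \<rho> = 1/\<kappa> gives a drop of
      \<open>(d t)\<^sup>2 / 64\<close>, exactly the amount by which the imbalance may grow. Hence
      the potential does not increase.\<close>
    moreover have "(d (Suc t))\<^sup>2 / \<rho> \<le> (d t)\<^sup>2 / \<rho> - (d t)\<^sup>2 / 64"
      using divide_right_mono[OF A, of \<rho>] \<rho> by (simp add: algebra_simps diff_divide_distrib)
    moreover have "X (Suc t) * e = X (Suc t)"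
      by (simp add: X_Suc left_diff_distrib XYe mult.assoc)
    moreover have "Y (Suc t) * e = Y (Suc t)"
      by (simp add: Y_Suc left_diff_distrib XYe mult.assoc)
    ultimately show ?case using B Suc by simp
  qed
  then show ?thesis by (simp add: d_def q_def \<rho>_def mult.commute)
qed

section \<open>Initialization\<close>

lemma op_bound_gl_orthogonal:
  assumes "gl R (tp R)"
  shows "op_bound R 1"
  unfolding op_bound_def
proof (intro conjI allI)
  fix G
  have e1: "norm (e * G) \<le> norm G"
  proof -
    have "(norm (e * G))\<^sup>2 = inner G (e * G)"
      by (simp add: power2_norm_eq_inner inner_times_left tp_e e_e flip: mult.assoc)
    also have "\<dots> \<le> norm G * norm (e * G)" by (rule norm_cauchy_schwarz)
    finally show ?thesis
      by (cases "norm (e * G) = 0") (auto simp: power2_eq_square)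
  qed
  have "(norm (R * G))\<^sup>2 = inner G ((tp R * R) * G)"
    by (simp add: power2_norm_eq_inner inner_times_left mult.assoc)
  also have "\<dots> = inner G (e * G)" using assms by (simp add: gl_def)
  also have "\<dots> \<le> norm G * norm G"
    by (intro order_trans[OF norm_cauchy_schwarz] mult_left_mono e1) simp
  finally show "norm (R * G) \<le> 1 * norm G"
    by (simp add: power2_eq_square[symmetric] abs_le_square_iff[symmetric])
qed simp

text \<open>An orthogonal R belongs to both sides: it is an admissible alignment, which bounds the
  distance, and it only conjugates the imbalance, whose norm can then be read off from the rotated
  factors. A general invertible alignment would bound the distance but not the imbalance. In terms
  of \<rho> = \<alpha> / \<beta> all quantities become powers of \<rho> times a power of
  \<beta>.\<close>

lemma initial_bounds:
  assumes X_e: "X * e = X" and Y_e: "Y * e = Y" and gl: "gl R (tp R)"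
    and near: "sqrt (err (X * R) (Y * R)) \<le> \<alpha> ^ 4 / (3000 * \<beta> ^ 3)"
  shows "fdist X Y < \<alpha> ^ 3 / (2000 * \<beta>\<^sup>2)"
    and "norm (imbalance X Y) + \<beta>\<^sup>2 / \<alpha>\<^sup>2 * (fdist X Y)\<^sup>2 \<le> \<alpha> ^ 3 / (300 * \<beta>)"
proof -
  define \<rho> where "\<rho> = \<alpha> / \<beta>"
  have \<rho>: "0 < \<rho>" "\<rho> \<le> 1" using \<alpha>_pos \<alpha>_le_\<beta> \<beta>_pos by (auto simp: \<rho>_def)
  have \<alpha>: "\<alpha> = \<rho> * \<beta>" using \<beta>_pos by (simp add: \<rho>_def)
  have near': "sqrt (err (X * R) (Y * R)) \<le> \<rho> ^ 4 * \<beta> / 3000"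
    using near \<beta>_pos unfolding \<alpha> by (simp add: power_mult_distrib) (simp add: power4_eq_xxxx power3_eq_cube)
  have fd: "fdist X Y \<le> \<rho> ^ 4 * \<beta> / 3000"
    using fdist_le[OF gl, of X Y] near' by simp
  have p: "\<rho> ^ 4 \<le> \<rho> ^ 3" "\<rho> ^ 6 \<le> \<rho> ^ 3" "\<rho> ^ 4 \<le> \<rho>"
    using \<rho> power_decreasing[of 3 4 \<rho>] power_decreasing[of 3 6 \<rho>] power_decreasing[of 1 4 \<rho>] by auto
  have p3: "0 < \<rho> ^ 3 * \<beta>" using \<rho> \<beta>_pos by simp
  have "\<rho> ^ 4 * \<beta> / 3000 \<le> \<rho> ^ 3 * \<beta> / 3000" using p \<beta>_pos by simp
  also have "\<dots> < \<rho> ^ 3 * \<beta> / 2000" using p3 by linarith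
  also have "\<dots> = \<alpha> ^ 3 / (2000 * \<beta>\<^sup>2)"
    using \<beta>_pos unfolding \<alpha> by (simp add: power_mult_distrib) (simp add: power2_eq_square power3_eq_cube)
  finally show "fdist X Y < \<alpha> ^ 3 / (2000 * \<beta>\<^sup>2)" using fd by linarith
  have small: "sqrt (err (X * R) (Y * R)) \<le> \<alpha> / 10"
  proof -
    have "\<rho> ^ 4 * \<beta> \<le> \<rho> * \<beta>" using p \<beta>_pos by simp
    moreover have "0 < \<rho> * \<beta>" using \<rho> \<beta>_pos by simp
    ultimately show ?thesis using near' unfolding \<alpha> by linarith
  qed
  have R: "R * tp R = e" using gl by (simp add: gl_def)
  have conj: "tp Z * Z = R * (tp (Z * R) * (Z * R)) * tp R" if "Z * e = Z" for Z
  proof -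
    have Z: "Z * R * tp R = Z" using R that by (simp add: mult.assoc)
    have "R * tp (Z * R) = tp Z" using arg_cong[OF Z, of tp] by simp
    then have "tp Z * Z = (R * tp (Z * R)) * (Z * R * tp R)" by (simp only: Z)
    then show ?thesis by (simp only: mult.assoc)
  qed
  have "imbalance X Y = R * imbalance (X * R) (Y * R) * tp R"
    unfolding imbalance_def conj[OF X_e] conj[OF Y_e]
    by (simp only: left_diff_distrib right_diff_distrib)
  then have "norm (imbalance X Y) \<le> norm (imbalance (X * R) (Y * R))"
    using op_bound_right[OF op_bound_tp[OF op_bound_gl_orthogonal[OF gl]], of "R * imbalance (X * R) (Y * R)"]
      op_bound_left[OF op_bound_gl_orthogonal[OF gl], of "imbalance (X * R) (Y * R)"] by simp
  also have "\<dots> \<le> 21 / 5 * \<beta> * sqrt (err (X * R) (Y * R))"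
    by (rule imbalance_upper[OF small])
  also have "\<dots> \<le> 21 / 5 * \<beta> * (\<rho> ^ 4 * \<beta> / 3000)"
    using near' \<beta>_pos by (intro mult_left_mono) auto
  also have "\<dots> \<le> 21 / 15000 * (\<rho> ^ 3 * \<beta>\<^sup>2)"
    using p \<beta>_pos by (simp add: power2_eq_square)
  finally have imb: "norm (imbalance X Y) \<le> 21 / 15000 * (\<rho> ^ 3 * \<beta>\<^sup>2)" .
  \<comment> \<open>The weight is \<rho>^-2 and the squared radius has \<rho>^8, so this part of the
    potential is of order \<rho>^6 and far below the imbalance part.\<close>
  have "\<beta>\<^sup>2 / \<alpha>\<^sup>2 * (fdist X Y)\<^sup>2 \<le> \<beta>\<^sup>2 / \<alpha>\<^sup>2 * (\<rho> ^ 4 * \<beta> / 3000)\<^sup>2"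
    by (intro mult_left_mono power_mono fd fdist_nonneg) simp
  also have "\<dots> = \<rho> ^ 6 * \<beta>\<^sup>2 / 9000000"
    using \<beta>_pos \<rho> unfolding \<alpha> by (simp add: power_mult_distrib power_divide field_simps eval_nat_numeral)
  also have "\<dots> \<le> \<rho> ^ 3 * \<beta>\<^sup>2 / 9000000" using p \<beta>_pos by simp
  finally have "\<beta>\<^sup>2 / \<alpha>\<^sup>2 * (fdist X Y)\<^sup>2 \<le> \<rho> ^ 3 * \<beta>\<^sup>2 / 9000000" .
  moreover have "\<alpha> ^ 3 / (300 * \<beta>) = \<rho> ^ 3 * \<beta>\<^sup>2 / 300"
    using \<beta>_pos unfolding \<alpha> by (simp add: power_mult_distrib) (simp add: power2_eq_square power3_eq_cube)
  moreover have "0 < \<rho> ^ 3 * \<beta>\<^sup>2" using \<rho> \<beta>_pos by simp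
  ultimately show "norm (imbalance X Y) + \<beta>\<^sup>2 / \<alpha>\<^sup>2 * (fdist X Y)\<^sup>2 \<le> \<alpha> ^ 3 / (300 * \<beta>)"
    using imb by linarith
qed

end

section \<open>From real matrices to the algebra\<close>

lift_definition fm :: "real mat \<Rightarrow> fmat"
  is "\<lambda>A i j. if i < dim_row A \<and> j < dim_col A then A $$ (i, j) else 0"
proof -
  fix A :: "real mat"
  show "\<exists>N. \<forall>i j. N \<le> i \<or> N \<le> j \<longrightarrow> (if i < dim_row A \<and> j < dim_col A then A $$ (i, j) else 0) = 0"
    by (rule exI[of _ "max (dim_row A) (dim_col A)"]) auto
qed

lemma entry_fm_mult:
  "entry (fm A * B) i j = (if i < dim_row A then \<Sum>k<dim_col A. A $$ (i, k) * entry B k j else 0)"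
proof -
  have "entry (fm A * B) i j = (\<Sum>k<dim_col A. entry (fm A) i k * entry B k j)"
    unfolding times_fmat.rep_eq by (rule sum_nonzero_eq) (auto simp: fm.rep_eq)
  then show ?thesis by (simp add: fm.rep_eq)
qed

lemma fm_mult:
  assumes "dim_col A = dim_row B"
  shows "fm (A * B) = fm A * fm B"
proof (rule fmat_eqI)
  fix i j
  show "entry (fm (A * B)) i j = entry (fm A * fm B) i j"
    using assms unfolding entry_fm_mult
    by (auto simp: fm.rep_eq scalar_prod_def atLeast0LessThan intro!: sum.cong)
qed

lemma fm_transpose: "fm (transpose_mat A) = tp (fm A)"
  by (auto intro!: fmat_eqI simp: fm.rep_eq tp.rep_eq)

lemma fm_minus:
  assumes "dim_row A = dim_row B" "dim_col A = dim_col B"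
  shows "fm (A - B) = fm A - fm B"
  using assms by (auto intro!: fmat_eqI simp: fm.rep_eq)

lemma fm_add:
  assumes "dim_row A = dim_row B" "dim_col A = dim_col B"
  shows "fm (A + B) = fm A + fm B"
  using assms by (auto intro!: fmat_eqI simp: fm.rep_eq plus_fmat.rep_eq)

lemma fm_smult: "fm (c \<cdot>\<^sub>m A) = c *\<^sub>R fm A"
  by (auto intro!: fmat_eqI simp: fm.rep_eq scaleR_fmat.rep_eq)

lemma frob_eq_norm: "frob A = norm (fm A)"
proof -
  have "inner (fm A) (fm A) = (\<Sum>p\<in>{..<dim_row A} \<times> {..<dim_col A}.
      entry (fm A) (fst p) (snd p) * entry (fm A) (fst p) (snd p))"
    unfolding inner_fmat.rep_eq by (rule sum_nonzero_eq) (auto simp: fm.rep_eq)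
  also have "\<dots> = (\<Sum>i<dim_row A. \<Sum>j<dim_col A. entry (fm A) i j * entry (fm A) i j)"
    by (simp add: sum.cartesian_product split_beta)
  also have "\<dots> = (\<Sum>i<dim_row A. \<Sum>j<dim_col A. (A $$ (i, j))\<^sup>2)"
    by (simp add: fm.rep_eq power2_eq_square)
  finally show ?thesis by (simp add: frob_def norm_fmat_def)
qed

lemma fm_inject:
  assumes "fm A = fm B" "dim_row A = dim_row B" "dim_col A = dim_col B"
  shows "A = B"
proof (rule eq_matI)
  fix i j assume "i < dim_row B" "j < dim_col B"
  then show "A $$ (i, j) = B $$ (i, j)"
    using arg_cong[OF assms(1), of "\<lambda>M. entry M i j"] assms(2,3) by (simp add: fm.rep_eq)
qed (use assms in auto)

lemma entry_one_mult: "entry (fm (1\<^sub>m r) * G) i j = (if i < r then entry G i j else 0)"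
  by (simp add: entry_fm_mult if_distrib[of "\<lambda>x. x * _"] sum.delta cong: if_cong)

lemma tp_fm_one: "tp (fm (1\<^sub>m r)) = fm (1\<^sub>m r)"
  by (simp flip: fm_transpose)

lemma entry_mult_one: "entry (G * fm (1\<^sub>m r)) i j = (if j < r then entry G i j else 0)"
proof -
  have "entry (G * fm (1\<^sub>m r)) i j = entry (tp (G * fm (1\<^sub>m r))) j i" by (simp only: tp.rep_eq)
  also have "\<dots> = entry (fm (1\<^sub>m r) * tp G) j i" by (simp only: tp_mult tp_fm_one)
  finally show ?thesis by (simp add: entry_one_mult tp.rep_eq)
qed

text \<open>Elements fixed by the corner on both sides are exactly the embedded r by r matrices.
  Abstract alignments are thereby genuine matrices.\<close>

lemma fm_surj:
  assumes "fm (1\<^sub>m r) * G = G" "G * fm (1\<^sub>m r) = G"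
  obtains A where "A \<in> carrier_mat r r" "fm A = G"
proof
  show "mat r r (\<lambda>(i, j). entry G i j) \<in> carrier_mat r r" by simp
  show "fm (mat r r (\<lambda>(i, j). entry G i j)) = G"
    using assms by (intro fmat_eqI) (metis (no_types, lifting) entry_one_mult entry_mult_one fm.rep_eq dim_row_mat(1) dim_col_mat(1) index_mat(1) case_prod_conv)
qed

lemma fm_one_mult: "A \<in> carrier_mat r c \<Longrightarrow> fm (1\<^sub>m r) * fm A = fm A"
  using fm_mult[of "1\<^sub>m r" A] by simp

lemma fm_mult_one: "A \<in> carrier_mat c r \<Longrightarrow> fm A * fm (1\<^sub>m r) = fm A"
  using fm_mult[of A "1\<^sub>m r"] by simp

lemma norm_le_entrywise:
  assumes "\<And>i j. \<bar>entry A i j\<bar> \<le> c * \<bar>entry B i j\<bar>" "0 \<le> c"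
  shows "norm A \<le> c * norm B"
proof -
  obtain N where "\<forall>D\<in>{A, B}. supported N D"
    using common_support by (metis finite.emptyI finite.insertI)
  then have N: "supported N A" "supported N B" by auto
  have sq: "entry A i j * entry A i j \<le> c\<^sup>2 * (entry B i j * entry B i j)" for i j
    using power_mono[OF assms(1), of i j 2] by (simp add: power_mult_distrib) (simp add: power2_eq_square)
  have "inner A A \<le> c\<^sup>2 * inner B B"
    unfolding inner_fmat_eq[OF N(1)] inner_fmat_eq[OF N(2)] sum_distrib_left
    by (intro sum_mono sq)
  then have "(norm A)\<^sup>2 \<le> (c * norm B)\<^sup>2"
    by (simp add: power2_norm_eq_inner power_mult_distrib)
  then show ?thesis by (rule power2_le_imp_le) (use assms(2) in auto)
qed

text \<open>The algebra is not complete, so there is no Neumann series to invoke. Instead, a null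
  vector of I + G, viewed as a one-column matrix W, would satisfy W = - G W and hence |W| \<le> |W|
  / 2.\<close>

lemma fm_one_plus_inverse:
  assumes G: "fm (1\<^sub>m r) * G = G" "G * fm (1\<^sub>m r) = G" and small: "norm G \<le> 1 / 2"
  obtains B where "B \<in> carrier_mat r r" "(fm (1\<^sub>m r) + G) * fm B = fm (1\<^sub>m r)"
    "fm B * (fm (1\<^sub>m r) + G) = fm (1\<^sub>m r)"
proof -
  obtain A0 where A0: "A0 \<in> carrier_mat r r" "fm A0 = G" using fm_surj[OF G] .
  define A where "A = 1\<^sub>m r + A0"
  have A: "A \<in> carrier_mat r r" "fm A = fm (1\<^sub>m r) + G"
    using A0 by (auto simp: A_def fm_add)
  have "det A \<noteq> 0"
  proof
    assume "det A = 0"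
    then obtain v where v: "v \<in> carrier_vec r" "v \<noteq> 0\<^sub>v r" "A *\<^sub>v v = 0\<^sub>v r"
      using det_0_iff_vec_prod_zero[OF A(1)] by blast
    define W where "W = mat r 1 (\<lambda>(i, j). v $ i)"
    have W: "W \<in> carrier_mat r 1" by (simp add: W_def)
    have "A * W = 0\<^sub>m r 1"
    proof (rule eq_matI)
      fix i j assume "i < dim_row (0\<^sub>m r 1 :: real mat)" "j < dim_col (0\<^sub>m r 1 :: real mat)"
      then have ij: "i < r" "j = 0" by auto
      have "col W 0 = v" using v(1) by (auto simp: W_def)
      then show "(A * W) $$ (i, j) = 0\<^sub>m r 1 $$ (i, j)"
        using ij A W arg_cong[OF v(3), of "\<lambda>w. w $ i"] by simp
    qed (use A W in auto)
    then have "fm (A * W) = 0" by (auto intro!: fmat_eqI simp: fm.rep_eq zero_fmat.rep_eq)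
    then have "fm W = - (G * fm W)"
      using A W fm_one_mult[OF W] by (simp add: fm_mult distrib_right eq_neg_iff_add_eq_0)
    then have "norm (fm W) = norm (G * fm W)" by (metis norm_minus_cancel)
    also have "\<dots> \<le> 1 / 2 * norm (fm W)"
      by (intro order_trans[OF norm_mult_ineq] mult_right_mono small) simp
    finally have "fm W = 0" by simp
    then have W0: "entry (fm W) i 0 = 0" for i by (simp add: zero_fmat.rep_eq)
    have "v $ i = 0" if "i < r" for i
      using W0[of i] that by (simp add: fm.rep_eq W_def)
    then show False using v(1,2) by auto
  qed
  then have "A \<in> Units (ring_mat TYPE(real) r ())" by (rule det_non_zero_imp_unit[OF A(1)])
  then obtain B where B: "B \<in> carrier_mat r r" "B * A = 1\<^sub>m r" "A * B = 1\<^sub>m r"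
    by (auto simp: Units_def ring_mat_def)
  show thesis
  proof (rule that[OF B(1)])
    show "(fm (1\<^sub>m r) + G) * fm B = fm (1\<^sub>m r)"
      using A B fm_mult[of A B] by simp
    show "fm B * (fm (1\<^sub>m r) + G) = fm (1\<^sub>m r)"
      using A B fm_mult[of B A] by simp
  qed
qed

lemma sum_lessThan_add: "(\<Sum>i<m + n. f i) = (\<Sum>i<m. f i) + (\<Sum>i<n. f (m + i))"
  for f :: "nat \<Rightarrow> real"
  by (induction n) auto

lemma frob_stack_diff:
  assumes "X \<in> carrier_mat n1 r" "Y \<in> carrier_mat n2 r" "A \<in> carrier_mat n1 r" "B \<in> carrier_mat n2 r"
    and "R \<in> carrier_mat r r"
  shows "(frob (stack X Y * R - stack A B))\<^sup>2 = (frob (X * R - A))\<^sup>2 + (frob (Y * R - B))\<^sup>2"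
proof -
  have top: "(stack X Y * R - stack A B) $$ (i, j) = (X * R - A) $$ (i, j)" if "i < n1" "j < r" for i j
    using assms that by (auto simp: stack_def scalar_prod_def intro!: sum.cong)
  have bot: "(stack X Y * R - stack A B) $$ (n1 + i, j) = (Y * R - B) $$ (i, j)" if "i < n2" "j < r" for i j
    using assms that by (auto simp: stack_def scalar_prod_def intro!: sum.cong)
  have dims: "dim_row (stack X Y * R - stack A B) = n1 + n2" "dim_col (stack X Y * R - stack A B) = r"
    "dim_row (X * R - A) = n1" "dim_col (X * R - A) = r" "dim_row (Y * R - B) = n2" "dim_col (Y * R - B) = r"
    using assms by (auto simp: stack_def)
  show ?thesis
    unfolding frob_def dims using top bot by (simp add: sum_lessThan_add sum_nonneg del: index_minus_mat)
qed

section \<open>The singular value decomposition as ground truth\<close>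

context
  fixes n1 n2 r :: nat and Ms U S V :: "real mat"
  assumes r: "0 < r" and svd: "compact_svd n1 n2 r Ms U S V"
begin

lemma svd_carrier:
  "Ms \<in> carrier_mat n1 n2" "U \<in> carrier_mat n1 r" "S \<in> carrier_mat r r" "V \<in> carrier_mat n2 r"
  "diag_sqrt S \<in> carrier_mat r r" "U * diag_sqrt S \<in> carrier_mat n1 r" "V * diag_sqrt S \<in> carrier_mat n2 r"
  using svd by (auto simp: compact_svd_def diag_sqrt_def)

lemma sigma_bounds:
  assumes "i < r"
  shows "sigma_min S \<le> S $$ (i, i)" "S $$ (i, i) \<le> sigma_max S"
  unfolding sigma_min_def sigma_max_def using assms svd_carrier
  by (auto intro!: Min_le Max_ge)

lemma sigma_min_pos: "0 < sigma_min S"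
proof -
  have "sigma_min S \<in> {S $$ (i, i) | i. i < dim_row S}"
    unfolding sigma_min_def using r svd_carrier by (intro Min_in) auto
  then show ?thesis using svd by (auto simp: compact_svd_def)
qed

lemma sigma_min_le_max: "sigma_min S \<le> sigma_max S"
  using sigma_bounds[OF r] by linarith

lemma entry_diag_sqrt_mult:
  "entry (fm (diag_sqrt S) * G) i j = (if i < r then sqrt (S $$ (i, i)) * entry G i j else 0)"
  using svd_carrier by (simp add: entry_fm_mult) (simp add: diag_sqrt_def if_distrib[of "\<lambda>x. x * _"] sum.delta' cong: if_cong)

lemma fm_diag_sqrt_squared: "fm (diag_sqrt S) * tp (fm (diag_sqrt S)) = fm S"
proof (rule fmat_eqI)
  fix i j
  have "S $$ (i, j) = 0" if "i < r" "j < r" "i \<noteq> j"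
    using svd that by (auto simp: compact_svd_def diagonal_mat_def)
  moreover have "0 < S $$ (i, i)" if "i < r" using svd that by (auto simp: compact_svd_def)
  ultimately show "entry (fm (diag_sqrt S) * tp (fm (diag_sqrt S))) i j = entry (fm S) i j"
    using svd_carrier by (auto simp: entry_diag_sqrt_mult tp.rep_eq fm.rep_eq) (auto simp: diag_sqrt_def less_imp_le)
qed

lemma orthonormal_UV: "tp (fm U) * fm U = fm (1\<^sub>m r)" "tp (fm V) * fm V = fm (1\<^sub>m r)"
  using svd fm_mult[of "transpose_mat U" U] fm_mult[of "transpose_mat V" V]
  by (auto simp: compact_svd_def fm_transpose)

lemma svd_factors: "fm Ms = fm (U * diag_sqrt S) * tp (fm (V * diag_sqrt S))"
proof -
  have "fm Ms = fm U * fm S * tp (fm V)"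
    using svd svd_carrier by (simp add: compact_svd_def fm_mult fm_transpose mult.assoc)
  then show ?thesis
    using svd_carrier by (simp add: fm_mult mult.assoc flip: fm_diag_sqrt_squared)
qed

text \<open>Orthonormal columns drop out of norms and Gram matrices. Both Gram matrices reduce to
  that of the square root of the diagonal factor, and the operator bounds become entrywise
  comparisons with its diagonal.\<close>

lemma svd_balanced_factors:
  "balanced_factors (fm (U * diag_sqrt S)) (fm (V * diag_sqrt S)) (fm (1\<^sub>m r))
    (sqrt (sigma_min S)) (sqrt (sigma_max S))"
proof
  let ?D = "fm (diag_sqrt S)" and ?e = "fm (1\<^sub>m r)"
  show "tp ?e = ?e" by (rule tp_fm_one)
  show "fm (U * diag_sqrt S) * ?e = fm (U * diag_sqrt S)" "fm (V * diag_sqrt S) * ?e = fm (V * diag_sqrt S)"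
    "?e * ?e = ?e"
    by (rule fm_mult_one[OF svd_carrier(6)], rule fm_mult_one[OF svd_carrier(7)], rule fm_mult_one[OF one_carrier_mat])
  show "0 < sqrt (sigma_min S)" "sqrt (sigma_min S) \<le> sqrt (sigma_max S)"
    using sigma_min_pos sigma_min_le_max by auto
  have UD: "fm (U * diag_sqrt S) = fm U * ?D" "fm (V * diag_sqrt S) = fm V * ?D"
    using svd_carrier by (simp_all add: fm_mult)
  have eD: "?e * ?D = ?D" using svd_carrier by (intro fm_one_mult)
  show "tp (fm (U * diag_sqrt S)) * fm (U * diag_sqrt S) = tp (fm (V * diag_sqrt S)) * fm (V * diag_sqrt S)"
    unfolding UD tp_mult using orthonormal_UV eD by (metis mult.assoc)
  fix G
  have "(norm (fm (U * diag_sqrt S) * G))\<^sup>2 = inner (?D * G) (tp (fm U) * fm U * (?D * G))"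
    by (simp add: UD power2_norm_eq_inner inner_times_left mult.assoc)
  also have "\<dots> = (norm (?D * G))\<^sup>2"
    unfolding orthonormal_UV using eD by (simp add: power2_norm_eq_inner flip: mult.assoc)
  finally have norm_UD: "norm (fm (U * diag_sqrt S) * G) = norm (?D * G)" by simp
  have s: "sqrt (sigma_min S) \<le> \<bar>sqrt (S $$ (i, i))\<bar>" "\<bar>sqrt (S $$ (i, i))\<bar> \<le> sqrt (sigma_max S)" if "i < r" for i
    using sigma_bounds[OF that] sigma_min_pos by auto
  have pos: "0 < sqrt (sigma_min S)" using sigma_min_pos by simp
  have "norm (?e * G) \<le> 1 / sqrt (sigma_min S) * norm (?D * G)"
  proof (rule norm_le_entrywise)
    fix i j
    have "sqrt (sigma_min S) * \<bar>entry (?e * G) i j\<bar> \<le> \<bar>entry (?D * G) i j\<bar>"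
      using s(1)[of i] by (auto simp: entry_one_mult entry_diag_sqrt_mult abs_mult intro: mult_right_mono)
    then show "\<bar>entry (?e * G) i j\<bar> \<le> 1 / sqrt (sigma_min S) * \<bar>entry (?D * G) i j\<bar>"
      using pos by (simp add: pos_le_divide_eq mult.commute)
  qed (use pos in simp)
  then show "sqrt (sigma_min S) * norm (?e * G) \<le> norm (fm (U * diag_sqrt S) * G)"
    using pos unfolding norm_UD by (simp add: pos_le_divide_eq mult.commute)
  show "norm (fm (U * diag_sqrt S) * G) \<le> sqrt (sigma_max S) * norm G"
    unfolding norm_UD
  proof (rule norm_le_entrywise)
    fix i j
    show "\<bar>entry (?D * G) i j\<bar> \<le> sqrt (sigma_max S) * \<bar>entry G i j\<bar>"
      using s(2)[of i] sigma_min_pos sigma_min_le_max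
      by (auto simp: entry_diag_sqrt_mult abs_mult intro: mult_right_mono)
  qed (use sigma_min_pos sigma_min_le_max in simp)
qed

interpretation balanced_factors "fm (U * diag_sqrt S)" "fm (V * diag_sqrt S)" "fm (1\<^sub>m r)"
    "sqrt (sigma_min S)" "sqrt (sigma_max S)"
  by (rule svd_balanced_factors)

lemma gl_fm_iff:
  assumes "P \<in> carrier_mat r r" "Q \<in> carrier_mat r r"
  shows "gl (fm P) (fm Q) \<longleftrightarrow> P * Q = 1\<^sub>m r \<and> Q * P = 1\<^sub>m r"
proof -
  have "fm P * fm Q = fm (P * Q)" "fm Q * fm P = fm (Q * P)" using assms by (simp_all add: fm_mult)
  then have "gl (fm P) (fm Q) \<longleftrightarrow> fm (P * Q) = fm (1\<^sub>m r) \<and> fm (Q * P) = fm (1\<^sub>m r)"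
    using assms by (auto simp: gl_def fm_one_mult fm_mult_one)
  then show ?thesis using assms by (auto intro: fm_inject)
qed

lemma inverse_near_identity:
  assumes "fm (1\<^sub>m r) * G = G" "G * fm (1\<^sub>m r) = G" "norm G \<le> 1 / 2"
  shows "\<exists>H. gl (fm (1\<^sub>m r) + G) H"
proof -
  obtain B where B: "B \<in> carrier_mat r r" "(fm (1\<^sub>m r) + G) * fm B = fm (1\<^sub>m r)"
    "fm B * (fm (1\<^sub>m r) + G) = fm (1\<^sub>m r)"
    using fm_one_plus_inverse[OF assms] .
  have "gl (fm (1\<^sub>m r) + G) (fm B)"
    unfolding gl_def B(2,3) fm_one_mult[OF B(1)] fm_mult_one[OF B(1)]
    by (simp add: distrib_left distrib_right e_e assms(1,2))
  then show ?thesis by blast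
qed

lemma err_fm:
  assumes "X \<in> carrier_mat n1 r" "Y \<in> carrier_mat n2 r" "P \<in> carrier_mat r r" "Q \<in> carrier_mat r r"
  shows "err (fm X * fm P) (fm Y * tp (fm Q))
    = (frob (X * P - U * diag_sqrt S))\<^sup>2 + (frob (Y * transpose_mat Q - V * diag_sqrt S))\<^sup>2"
  using assms svd_carrier unfolding err_def frob_eq_norm
  by (simp add: fm_minus fm_mult fm_transpose)

lemma factor_dist_eq_fdist:
  assumes "X \<in> carrier_mat n1 r" "Y \<in> carrier_mat n2 r"
  shows "factor_dist X Y (U * diag_sqrt S) (V * diag_sqrt S) = fdist (fm X) (fm Y)"
proof -
  have "{sqrt ((frob (X * P - U * diag_sqrt S))\<^sup>2 + (frob (Y * transpose_mat Q - V * diag_sqrt S))\<^sup>2) | P Q.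
       P \<in> carrier_mat (dim_col X) (dim_col X) \<and> Q \<in> carrier_mat (dim_col X) (dim_col X) \<and>
       P * Q = 1\<^sub>m (dim_col X) \<and> Q * P = 1\<^sub>m (dim_col X)}
    = {sqrt (err (fm X * P) (fm Y * tp Q)) | P Q. gl P Q}" (is "?A = ?B")
  proof
    show "?A \<subseteq> ?B"
    proof
      fix x assume "x \<in> ?A"
      then obtain P Q where "P \<in> carrier_mat r r" "Q \<in> carrier_mat r r" "P * Q = 1\<^sub>m r" "Q * P = 1\<^sub>m r"
        and "x = sqrt ((frob (X * P - U * diag_sqrt S))\<^sup>2 + (frob (Y * transpose_mat Q - V * diag_sqrt S))\<^sup>2)"
        using assms by auto
      then show "x \<in> ?B" using gl_fm_iff[of P Q] err_fm[OF assms, of P Q] by force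
    qed
    show "?B \<subseteq> ?A"
    proof
      fix x assume "x \<in> ?B"
      then obtain P Q where PQ: "gl P Q" and x: "x = sqrt (err (fm X * P) (fm Y * tp Q))" by blast
      \<comment> \<open>Abstract alignments range over the whole algebra a priori; the corner
        conditions in \<open>gl\<close> bring them back to r by r matrices, so the two infima run
        over the same set.\<close>
      obtain P' where P': "P' \<in> carrier_mat r r" "fm P' = P" using PQ fm_surj[of r P] by (auto simp: gl_def)
      obtain Q' where Q': "Q' \<in> carrier_mat r r" "fm Q' = Q" using PQ fm_surj[of r Q] by (auto simp: gl_def)
      show "x \<in> ?A"
        using assms P' Q' PQ x gl_fm_iff[of P' Q'] err_fm[OF assms, of P' Q'] by auto
    qed
  qed
  then show ?thesis by (simp add: factor_dist_def fdist_def)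
qed

text \<open>Since \<kappa> = (\<beta>/\<alpha>)^2, the radius of the initialization is
  (\<alpha>/\<beta>)^3 \<alpha>, a form free of real exponents.\<close>

lemma condition_number_powr:
  "1 / (sigma_max S / sigma_min S) powr (3 / 2) * sqrt (sigma_min S)
    = sqrt (sigma_min S) ^ 4 / sqrt (sigma_max S) ^ 3"
proof -
  define \<alpha> \<beta> where "\<alpha> = sqrt (sigma_min S)" and "\<beta> = sqrt (sigma_max S)"
  have pos: "0 < \<alpha>" "0 < \<beta>" using sigma_min_pos sigma_min_le_max by (auto simp: \<alpha>_def \<beta>_def)
  have "sigma_max S / sigma_min S = (\<beta> / \<alpha>) powr 2"
    using pos sigma_min_pos sigma_min_le_max by (simp add: \<alpha>_def \<beta>_def power_divide)
  then have "(sigma_max S / sigma_min S) powr (3 / 2) = (\<beta> / \<alpha>) powr 3"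
    by (simp only: powr_powr) simp
  also have "\<dots> = (\<beta> / \<alpha>) ^ 3" using pos by simp
  finally show ?thesis
    using pos by (simp add: \<alpha>_def[symmetric] \<beta>_def[symmetric] power_divide eval_nat_numeral)
qed

lemma gradient_descent_convergence:
  fixes X Y :: "nat \<Rightarrow> real mat"
  assumes X0: "X 0 \<in> carrier_mat n1 r" and Y0: "Y 0 \<in> carrier_mat n2 r"
    and init: "Inf {frob (stack (X 0) (Y 0) * R - stack (U * diag_sqrt S) (V * diag_sqrt S)) | R. R \<in> orth_mats r}
      \<le> 1 / 4000 * (1 / (sigma_max S / sigma_min S) powr (3 / 2)) * sqrt (sigma_min S)"
    and X_Suc: "\<And>t. X (Suc t) = X t - (1 / 32 / sigma_max S) \<cdot>\<^sub>m ((X t * transpose_mat (Y t) - Ms) * Y t)"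
    and Y_Suc: "\<And>t. Y (Suc t) = Y t - (1 / 32 / sigma_max S) \<cdot>\<^sub>m (transpose_mat (X t * transpose_mat (Y t) - Ms) * X t)"
  shows "factor_dist (X t) (Y t) (U * diag_sqrt S) (V * diag_sqrt S)
    \<le> (1 - 1 / 32 / (50 * (sigma_max S / sigma_min S))) ^ t
      * factor_dist (X 0) (Y 0) (U * diag_sqrt S) (V * diag_sqrt S)"
proof -
  define Zs where "Zs = stack (U * diag_sqrt S) (V * diag_sqrt S)"
  define b where "b = sqrt (sigma_min S) ^ 4 / sqrt (sigma_max S) ^ 3"
  have "0 < b" using sigma_min_pos sigma_min_le_max by (simp add: b_def)
  have "Inf {frob (stack (X 0) (Y 0) * R - Zs) | R. R \<in> orth_mats r} \<le> 1 / 4000 * b"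
    using init condition_number_powr by (simp add: Zs_def b_def mult.assoc)
  \<comment> \<open>The gap between 1/4000 and 1/3000 yields an actual orthogonal R from the
    infimum, without a compactness argument.\<close>
  also have "\<dots> < b / 3000" using \<open>0 < b\<close> by simp
  finally have "Inf {frob (stack (X 0) (Y 0) * R - Zs) | R. R \<in> orth_mats r} < b / 3000" .
  moreover have "1\<^sub>m r \<in> orth_mats r" by (simp add: orth_mats_def)
  ultimately obtain R where R: "R \<in> orth_mats r" and near: "frob (stack (X 0) (Y 0) * R - Zs) < b / 3000"
    by (subst (asm) cInf_less_iff) (auto simp: frob_eq_norm intro!: bdd_belowI[of _ 0])
  have Rc: "R \<in> carrier_mat r r" "transpose_mat R * R = 1\<^sub>m r" using R by (auto simp: orth_mats_def)
  have "R * transpose_mat R = 1\<^sub>m r"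
    using mat_mult_left_right_inverse[of "transpose_mat R" r R] Rc by simp
  then have gl_R: "gl (fm R) (tp (fm R))"
    using gl_fm_iff[of R "transpose_mat R"] Rc by (simp add: fm_transpose)
  have "err (fm (X 0) * fm R) (fm (Y 0) * fm R) = (frob (stack (X 0) (Y 0) * R - Zs))\<^sup>2"
    using err_fm[OF X0 Y0, of R "transpose_mat R"] Rc svd_carrier X0 Y0
    by (simp add: frob_stack_diff[OF X0 Y0] Zs_def fm_transpose)
  then have near': "sqrt (err (fm (X 0) * fm R) (fm (Y 0) * fm R))
      \<le> sqrt (sigma_min S) ^ 4 / (3000 * sqrt (sigma_max S) ^ 3)"
    using near by (simp add: frob_eq_norm b_def)
  have XY: "X t \<in> carrier_mat n1 r \<and> Y t \<in> carrier_mat n2 r" for t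
    by (induction t) (use X0 Y0 svd_carrier in \<open>auto simp: X_Suc Y_Suc\<close>)
  have b2: "(sqrt (sigma_max S))\<^sup>2 = sigma_max S" "(sqrt (sigma_min S))\<^sup>2 = sigma_min S"
    using sigma_min_pos sigma_min_le_max by simp_all
  have res: "fm (X t * transpose_mat (Y t) - Ms) = residual (fm (X t)) (fm (Y t))" for t
  proof -
    have "X t \<in> carrier_mat n1 r" "Y t \<in> carrier_mat n2 r" using XY by auto
    then show ?thesis
      using svd_carrier(1) unfolding residual_def svd_factors[symmetric]
      by (subst fm_minus) (auto simp: fm_mult fm_transpose)
  qed
  have fX: "fm (X (Suc t)) = fm (X t) - (1 / (32 * (sqrt (sigma_max S))\<^sup>2)) *\<^sub>R (residual (fm (X t)) (fm (Y t)) * fm (Y t))"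
    for t
  proof -
    have "X t \<in> carrier_mat n1 r" "Y t \<in> carrier_mat n2 r" using XY by auto
    then show ?thesis
      using svd_carrier(1) unfolding X_Suc b2 res[symmetric]
      by (subst fm_minus) (auto simp: fm_smult fm_mult)
  qed
  have fY: "fm (Y (Suc t)) = fm (Y t) - (1 / (32 * (sqrt (sigma_max S))\<^sup>2)) *\<^sub>R (tp (residual (fm (X t)) (fm (Y t))) * fm (X t))"
    for t
  proof -
    have "X t \<in> carrier_mat n1 r" "Y t \<in> carrier_mat n2 r" using XY by auto
    then show ?thesis
      using svd_carrier(1) unfolding Y_Suc b2 res[symmetric] fm_transpose[symmetric]
      by (subst fm_minus) (auto simp: fm_smult fm_mult)
  qed
  have Xe: "fm (X 0) * fm (1\<^sub>m r) = fm (X 0)" "fm (Y 0) * fm (1\<^sub>m r) = fm (Y 0)"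
    using X0 Y0 by (auto intro: fm_mult_one)
  have "fdist (fm (X t)) (fm (Y t))
      \<le> (1 - (sqrt (sigma_min S))\<^sup>2 / (1600 * (sqrt (sigma_max S))\<^sup>2)) ^ t * fdist (fm (X 0)) (fm (Y 0))"
    by (rule linear_convergence[of "\<lambda>t. fm (X t)" "\<lambda>t. fm (Y t)",
          OF inverse_near_identity Xe initial_bounds[OF Xe gl_R near'] fX fY])
  then show ?thesis
    using XY by (simp add: factor_dist_eq_fdist b2)
qed

end

text \<open>The witnesses are 1/4000 for the radius and 1/32 for the step size. By compactness of
  the orthogonal matrices, \<open>Inf\<close> over \<open>orth_mats r\<close> is the minimum in the
  informal statement. The condition \<open>0 < r\<close> makes the set of singular values nonempty,
  so that \<open>Max\<close> and \<open>Min\<close> are meaningful.\<close>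

theorem theorem2:
  "\<exists>c0 :: real. c0 > 0 \<and> (\<exists>\<eta> :: real. \<eta> > 0 \<and>
    (\<forall>(n1::nat) (n2::nat) (r::nat) Ms U S V (X :: nat \<Rightarrow> real mat) (Y :: nat \<Rightarrow> real mat).
       0 < r \<longrightarrow> compact_svd n1 n2 r Ms U S V \<longrightarrow>
       X 0 \<in> carrier_mat n1 r \<longrightarrow> Y 0 \<in> carrier_mat n2 r \<longrightarrow>
       (let Xs = U * diag_sqrt S; Ys = V * diag_sqrt S;
            \<kappa> = sigma_max S / sigma_min S in
        Inf {frob (stack (X 0) (Y 0) * R - stack Xs Ys) | R. R \<in> orth_mats r}
          \<le> c0 * (1 / \<kappa> powr (3/2)) * sqrt (sigma_min S) \<longrightarrow>
        (\<forall>t. X (Suc t) = X t - (\<eta> / sigma_max S) \<cdot>\<^sub>m ((X t * transpose_mat (Y t) - Ms) * Y t) \<and>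
              Y (Suc t) = Y t - (\<eta> / sigma_max S) \<cdot>\<^sub>m (transpose_mat (X t * transpose_mat (Y t) - Ms) * X t)) \<longrightarrow>
        (\<forall>t. factor_dist (X t) (Y t) Xs Ys \<le> (1 - \<eta> / (50 * \<kappa>)) ^ t * factor_dist (X 0) (Y 0) Xs Ys))))"
  unfolding Let_def
  by (intro exI[of _ "1 / 4000"] exI[of _ "1 / 32"] conjI allI impI gradient_descent_convergence) auto

end
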